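(* Let $\boldsymbol{\tau}=(\tau_n:\mathcal A_{n+1}^*\to\mathcal A_n^* )_{n\ge 0}$ be a constant length and recognizable directive sequence. The following are equivalent. (1) There exists a contraction $\boldsymbol{\tau}'=(\tau'_k=\tau_{[n_k,n_{k+1})})_{k\ge 0}$ of $\boldsymbol{\tau}$ such that the vectors $(v_k)_{k\ge 0}$ given by $$v_k(a)=\min_{b\in\mathcal A_{n_{k+1}}}|\tau'_k(b)|_a,\qquad a\in\mathcal A_{n_k},\ k\ge 0,$$ satisfy $$\sum_{k\ge 0}\frac{|v_k|}{|\tau'_k|}=+\infty,$$ where $|v_k|$ denotes the sum of the entries of $v_k$. (2) The system $(X_{\boldsymbol{\tau}},S)$ is uniquely ergodic.
   Context: Alphabets are finite nonempty sets; $S$ is the shift $(Sx)_n=x_{n+1}$. For a word $w$ and letter $a$, $|w|_a$ is the number of occurrences of $a$ in $w$. A directive sequence is a sequence $\boldsymbol{\tau}=(\tau_n:\mathcal A_{n+1}^*\to\mathcal A_n^* )_{n\ge 0}$ of nonerasing morphisms of free monoids (no letter is mapped to the empty word). For $n<N$, $\tau_{[n,N)}=\tau_n\circ\cdots\circ\tau_{N-1}$; $\tau_{[n,n)}$ is the identity. A morphism $\sigma$ has constant length if the length of $\sigma(a)$ does not depend on the letter $a$; this length is denoted $|\sigma|$. $\boldsymbol{\tau}$ has constant length if every $\tau_n$, $n\ge 0$, does. Let $\mathcal L^{(n)}(\boldsymbol{\tau})$ be the set of words over $\mathcal A_n$ occurring in $\tau_{[n,N)}(a)$ for some $N>n$,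 $a\in\mathcal A_N$; $X^{(n)}_{\boldsymbol{\tau}}$ is the set of $y\in\mathcal A_n^{\mathbb Z}$ all of whose finite factors are in $\mathcal L^{(n)}(\boldsymbol{\tau})$; $X_{\boldsymbol{\tau}}=X^{(0)}_{\boldsymbol{\tau}}$, understood to be nonempty. Morphisms act on bi-infinite sequences by concatenation, the image of the nonnegative coordinates starting at coordinate $0$. For $a\in\mathcal A_n$, $[a]=\{y\in X^{(n)}_{\boldsymbol{\tau}}:y_0=a\}$. $\boldsymbol{\tau}$ is recognizable if for every $n\ge 0$ the family of sets $S^k\tau_{[0,n)}([a])$, $a\in\mathcal A_n$, $0\le k<|\tau_{[0,n)}(a)|$, is a partition of $X_{\boldsymbol{\tau}}$ (sets with distinct indices are disjoint). A contraction of $\boldsymbol{\tau}$ is a directive sequence $(\tau'_k=\tau_{[n_k,n_{k+1})}:\mathcal A_{n_{k+1}}^*\to\mathcal A_{n_k}^* )_{k\ge 0}$ with $0=n_0<n_1<n_2<\cdots$. *)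

theory Defs
  imports "HOL-Probability.Probability" "HOL-Library.Sublist" "HOL-Library.Disjoint_Sets"
begin

section \<open>Morphisms and directive sequences\<close>

text \<open>The free monoid over an alphabet \<open>A\<close> is \<open>lists A\<close>. A morphism is a map on words; its values
  on lists that are not words over the source alphabet are irrelevant.\<close>

definition word_morphism :: "'a set \<Rightarrow> 'a set \<Rightarrow> ('a list \<Rightarrow> 'a list) \<Rightarrow> bool" where
  "word_morphism B A \<sigma> \<longleftrightarrow>
     (\<forall>u \<in> lists B. \<sigma> u \<in> lists A) \<and>
     \<sigma> [] = [] \<and>
     (\<forall>u \<in> lists B. \<forall>v \<in> lists B. \<sigma> (u @ v) = \<sigma> u @ \<sigma> v)"

definition nonerasing :: "'a set \<Rightarrow> ('a list \<Rightarrow> 'a list) \<Rightarrow> bool" where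
  "nonerasing B \<sigma> \<longleftrightarrow> (\<forall>a \<in> B. \<sigma> [a] \<noteq> [])"

definition constant_length :: "'a set \<Rightarrow> ('a list \<Rightarrow> 'a list) \<Rightarrow> bool" where
  "constant_length B \<sigma> \<longleftrightarrow> (\<exists>l. \<forall>a \<in> B. length (\<sigma> [a]) = l)"

text \<open>Only meaningful if \<open>\<sigma>\<close> has constant length on the nonempty alphabet \<open>B\<close>.\<close>

definition morphism_length :: "'a set \<Rightarrow> ('a list \<Rightarrow> 'a list) \<Rightarrow> nat" where
  "morphism_length B \<sigma> = (THE l. \<forall>a \<in> B. length (\<sigma> [a]) = l)"

definition directive_sequence :: "(nat \<Rightarrow> 'a set) \<Rightarrow> (nat \<Rightarrow> 'a list \<Rightarrow> 'a list) \<Rightarrow> bool" where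
  "directive_sequence A \<tau> \<longleftrightarrow>
     (\<forall>n. finite (A n) \<and> A n \<noteq> {} \<and>
          word_morphism (A (Suc n)) (A n) (\<tau> n) \<and> nonerasing (A (Suc n)) (\<tau> n))"

definition constant_length_sequence ::
    "(nat \<Rightarrow> 'a set) \<Rightarrow> (nat \<Rightarrow> 'a list \<Rightarrow> 'a list) \<Rightarrow> bool" where
  "constant_length_sequence A \<tau> \<longleftrightarrow> (\<forall>n. constant_length (A (Suc n)) (\<tau> n))"

text \<open>\<open>compose_range \<tau> n N\<close> is \<open>\<tau> n \<circ> \<dots> \<circ> \<tau> (N - 1)\<close>, and the identity if \<open>n = N\<close>.\<close>

definition compose_range ::
    "(nat \<Rightarrow> 'a list \<Rightarrow> 'a list) \<Rightarrow> nat \<Rightarrow> nat \<Rightarrow> 'a list \<Rightarrow> 'a list" where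
  "compose_range \<tau> n N = foldr (\<lambda>i f. \<tau> i \<circ> f) [n..<N] id"

definition is_contraction ::
    "(nat \<Rightarrow> 'a set) \<Rightarrow> (nat \<Rightarrow> 'a list \<Rightarrow> 'a list) \<Rightarrow>
     (nat \<Rightarrow> 'a set) \<Rightarrow> (nat \<Rightarrow> 'a list \<Rightarrow> 'a list) \<Rightarrow> bool" where
  "is_contraction A \<tau> A' \<tau>' \<longleftrightarrow>
     (\<exists>ns. ns 0 = 0 \<and> strict_mono ns \<and>
           (\<forall>k. A' k = A (ns k) \<and> \<tau>' k = compose_range \<tau> (ns k) (ns (Suc k))))"

section \<open>The subshifts generated by a directive sequence\<close>

definition level_language ::
    "(nat \<Rightarrow> 'a set) \<Rightarrow> (nat \<Rightarrow> 'a list \<Rightarrow> 'a list) \<Rightarrow> nat \<Rightarrow> 'a list set" where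
  "level_language A \<tau> n = {w. \<exists>N>n. \<exists>a \<in> A N. sublist w (compose_range \<tau> n N [a])}"

definition level_subshift ::
    "(nat \<Rightarrow> 'a set) \<Rightarrow> (nat \<Rightarrow> 'a list \<Rightarrow> 'a list) \<Rightarrow> nat \<Rightarrow> (int \<Rightarrow> 'a) set" where
  "level_subshift A \<tau> n =
     {y. (\<forall>i. y i \<in> A n) \<and> (\<forall>i j. map y [i..j] \<in> level_language A \<tau> n)}"

definition bi_shift :: "(int \<Rightarrow> 'a) \<Rightarrow> int \<Rightarrow> 'a" where
  "bi_shift x = (\<lambda>i. x (i + 1))"

text \<open>The image of a bi-infinite sequence under a nonerasing morphism. Since no letter is erased,
  the image of \<open>y 0 \<dots> y i\<close> has more than \<open>i\<close> letters and determines coordinate \<open>i \<ge> 0\<close> of the image;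
  likewise the image of \<open>y i \<dots> y (-1)\<close>, which ends at coordinate \<open>-1\<close>, determines coordinate
  \<open>i < 0\<close>.\<close>

definition bi_image :: "('a list \<Rightarrow> 'a list) \<Rightarrow> (int \<Rightarrow> 'a) \<Rightarrow> int \<Rightarrow> 'a" where
  "bi_image \<sigma> y = (\<lambda>i.
     if 0 \<le> i then \<sigma> (map y [0..i]) ! nat i
     else (let w = \<sigma> (map y [i..-1]) in w ! (length w - nat (- i))))"

definition letter_cylinder ::
    "(nat \<Rightarrow> 'a set) \<Rightarrow> (nat \<Rightarrow> 'a list \<Rightarrow> 'a list) \<Rightarrow> nat \<Rightarrow> 'a \<Rightarrow> (int \<Rightarrow> 'a) set" where
  "letter_cylinder A \<tau> n a = {y \<in> level_subshift A \<tau> n. y 0 = a}"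

text \<open>The partitions are indexed families; a set of the family may be empty, which happens when
  a letter of \<open>A n\<close> does not occur in the subshift of level \<open>n\<close>.\<close>

definition recognizable :: "(nat \<Rightarrow> 'a set) \<Rightarrow> (nat \<Rightarrow> 'a list \<Rightarrow> 'a list) \<Rightarrow> bool" where
  "recognizable A \<tau> \<longleftrightarrow>
     (\<forall>n. let I = (SIGMA a : A n. {..<length (compose_range \<tau> 0 n [a])});
              P = (\<lambda>(a, k). (bi_shift ^^ k) `
                     (bi_image (compose_range \<tau> 0 n) ` letter_cylinder A \<tau> n a))
          in disjoint_family_on P I \<and> (\<Union>p \<in> I. P p) = level_subshift A \<tau> 0)"

section \<open>Unique ergodicity\<close>

definition borel_sigma :: "'b topology \<Rightarrow> 'b measure" where
  "borel_sigma T = sigma (topspace T) {U. openin T U}"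

definition invariant_probability :: "'b topology \<Rightarrow> ('b \<Rightarrow> 'b) \<Rightarrow> 'b measure \<Rightarrow> bool" where
  "invariant_probability T f \<mu> \<longleftrightarrow>
     sets \<mu> = sets (borel_sigma T) \<and> prob_space \<mu> \<and>
     (\<forall>B \<in> sets \<mu>. emeasure \<mu> (f -` B \<inter> space \<mu>) = emeasure \<mu> B)"

definition uniquely_ergodic :: "'b topology \<Rightarrow> ('b \<Rightarrow> 'b) \<Rightarrow> bool" where
  "uniquely_ergodic T f \<longleftrightarrow> (\<exists>!\<mu>. invariant_probability T f \<mu>)"

definition subshift_topology :: "'a set \<Rightarrow> (int \<Rightarrow> 'a) set \<Rightarrow> (int \<Rightarrow> 'a) topology" where
  "subshift_topology A X = subtopology (product_topology (\<lambda>_. discrete_topology A) UNIV) X"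

section \<open>The minimum vectors\<close>

definition min_vector ::
    "(nat \<Rightarrow> 'a set) \<Rightarrow> (nat \<Rightarrow> 'a list \<Rightarrow> 'a list) \<Rightarrow> nat \<Rightarrow> 'a \<Rightarrow> nat" where
  "min_vector A \<tau> k a = Min ((\<lambda>b. count_list (\<tau> k [b]) a) ` A (Suc k))"

end

theory Submission
  imports Defs
begin

text \<open>Write \<open>\<sigma> n\<close> for \<open>\<tau>\<^bsub>[0,n)\<^esub>\<close> and \<open>h n\<close> for its length; nonemptiness of the subshift forces \<open>h n \<rightarrow> \<infinity>\<close>.
  By recognizability the towers over the sets \<open>\<sigma> n [a]\<close> partition the subshift, so every invariant
  probability gives a word \<open>w\<close> a mass that is, up to \<open>|w| / h n\<close>, a convex combination over the
  letters \<open>a\<close> of the frequencies of \<open>w\<close> in \<open>\<sigma> n (a)\<close>. The quotients \<open>|v\<^sub>k| / |\<tau>'\<^sub>k|\<close> are the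
  Doeblin coefficients of the column-stochastic matrices of letter frequencies; if their sum
  diverges, the oscillation in \<open>a\<close> of these frequencies tends to \<open>0\<close> and the mass of \<open>w\<close> is determined.

  Conversely, empirical measures of words \<open>\<tau>\<^bsub>[n,N)\<^esub>(b)\<close> accumulate at invariant probabilities \<open>\<nu>\<close>
  of level \<open>n\<close>, and averaging the images of \<open>\<nu>\<close> under \<open>S\<^sup>k \<circ> \<sigma> n\<close> for \<open>k < h n\<close> gives an invariant
  probability \<open>\<mu>\<close> of level \<open>0\<close> with \<open>\<nu>[a] = h n * \<mu>(\<sigma> n [a])\<close> by recognizability. If \<open>\<mu>\<close> is unique, the
  letter frequencies of \<open>\<tau>\<^bsub>[n,N)\<^esub>(b)\<close> therefore converge as \<open>N \<rightarrow> \<infinity>\<close>, uniformly in \<open>b\<close>, to a probability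
  vector. So for \<open>N\<close> large the minima over \<open>b\<close> sum to at least \<open>1 / 2\<close>, and a contraction along such
  levels has a divergent series.\<close>

section \<open>Subshifts and their Borel sets\<close>

text \<open>For each \<open>n\<close> an equivalence relation; its classes form a base of the
  product topology on the full shift, so openness, continuity and measurability can be phrased
  without product boxes.\<close>

definition agree :: "nat \<Rightarrow> (int \<Rightarrow> 'a) \<Rightarrow> (int \<Rightarrow> 'a) \<Rightarrow> bool" where
  "agree n x y \<longleftrightarrow> (\<forall>i. \<bar>i\<bar> \<le> int n \<longrightarrow> x i = y i)"

lemma agree_refl [simp]: "agree n x x"
  by (simp add: agree_def)

lemma agree_sym: "agree n x y \<Longrightarrow> agree n y x"
  by (simp add: agree_def)

lemma agree_trans: "agree n x y \<Longrightarrow> agree n y z \<Longrightarrow> agree n x z"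
  by (simp add: agree_def)

lemma agree_mono: "agree n x y \<Longrightarrow> m \<le> n \<Longrightarrow> agree m x y"
  by (simp add: agree_def)

lemma agree_map_eq:
  assumes "agree n x y" "\<And>k. i \<le> k \<Longrightarrow> k \<le> j \<Longrightarrow> \<bar>k\<bar> \<le> int n"
  shows "map x [i..j] = map y [i..j]"
  using assms by (auto simp: agree_def)

text \<open>A basic box constrains finitely many coordinates, which all lie in one symmetric window;
  conversely, fixing a window amounts to a box with finitely many singleton sides.\<close>

lemma openin_subshift_topology:
  assumes X: "X \<subseteq> {x. \<forall>i. x i \<in> A}"
  shows "openin (subshift_topology A X) U \<longleftrightarrow>
    U \<subseteq> X \<and> (\<forall>x\<in>U. \<exists>n. \<forall>y\<in>X. agree n x y \<longrightarrow> y \<in> U)" (is "?l \<longleftrightarrow> ?r")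
proof
  assume ?l
  then obtain V where V: "openin (product_topology (\<lambda>_. discrete_topology A) UNIV) V" "U = V \<inter> X"
    by (auto simp: subshift_topology_def openin_subtopology)
  have "\<exists>n. \<forall>y\<in>X. agree n x y \<longrightarrow> y \<in> U" if x: "x \<in> U" for x
  proof -
    from x V obtain W where fin: "finite {i. W i \<noteq> A}" and xW: "x \<in> PiE UNIV W"
      and sub: "PiE UNIV W \<subseteq> V"
      unfolding openin_product_topology_alt by force
    \<comment> \<open>The inserted \<open>0\<close> covers the case that no coordinate is
      constrained.\<close>
    define n where "n = Max (insert 0 ((\<lambda>i. nat \<bar>i\<bar>) ` {i. W i \<noteq> A}))"
    have n: "nat \<bar>i\<bar> \<le> n" if "W i \<noteq> A" for i
      unfolding n_def using fin that by (intro Max_ge) auto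
    have "y \<in> U" if y: "y \<in> X" "agree n x y" for y
    proof -
      have "y i \<in> W i" for i
      proof (cases "W i = A")
        case True
        then show ?thesis using y(1) X by auto
      next
        case False
        then have "\<bar>i\<bar> \<le> int n" using n by fastforce
        then have "y i = x i" using y(2) by (auto simp: agree_def)
        then show ?thesis using xW by auto
      qed
      then have "y \<in> V" using sub by (auto simp: PiE_def Pi_def)
      then show ?thesis using V(2) y by auto
    qed
    then show ?thesis by blast
  qed
  then show ?r using V(2) by blast
next
  assume r: ?r
  \<comment> \<open>In the subspace topology \<open>U\<close> has to be the trace of an open set of
    the full shift: \<open>V\<close> is the union of the windows around points of \<open>U\<close>
    that meet \<open>X\<close> only inside \<open>U\<close>.\<close>
  define V where "V = {y. (\<forall>i. y i \<in> A) \<and> (\<exists>x\<in>U. \<exists>n. agree n x y \<and> (\<forall>z\<in>X. agree n x z \<longrightarrow> z \<in> U))}"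
  have "openin (product_topology (\<lambda>_. discrete_topology A) UNIV) V"
    unfolding openin_product_topology_alt
  proof
    fix y assume y: "y \<in> V"
    then obtain x n where x: "x \<in> U" "agree n x y" "\<forall>z\<in>X. agree n x z \<longrightarrow> z \<in> U" and yA: "\<forall>i. y i \<in> A"
      by (auto simp: V_def)
    define W where "W = (\<lambda>i. if \<bar>i\<bar> \<le> int n then {y i} else A)"
    have "finite {i. W i \<noteq> A}"
      by (rule finite_subset[of _ "{-int n..int n}"]) (auto simp: W_def split: if_splits)
    moreover have "PiE UNIV W \<subseteq> V"
    proof
      fix z assume z: "z \<in> PiE UNIV W"
      then have zi: "z i \<in> W i" for i by auto
      have "agree n y z" unfolding agree_def using zi by (auto simp: W_def split: if_splits) (metis singletonD)
      moreover have "z i \<in> A" for i using zi[of i] yA by (auto simp: W_def split: if_splits)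
      ultimately show "z \<in> V" using x by (auto simp: V_def intro: agree_trans)
    qed
    moreover have "y \<in> PiE UNIV W" by (auto simp: W_def yA)
    moreover have "\<forall>i\<in>UNIV. openin (discrete_topology A) (W i)" by (auto simp: W_def yA)
    ultimately show "\<exists>U. finite {i \<in> UNIV. U i \<noteq> topspace (discrete_topology A)} \<and>
             (\<forall>i\<in>UNIV. openin (discrete_topology A) (U i)) \<and> y \<in> PiE UNIV U \<and> PiE UNIV U \<subseteq> V"
      by (intro exI[of _ W]) auto
  qed
  moreover have "U = V \<inter> X"
  proof
    show "U \<subseteq> V \<inter> X"
    proof
      fix x assume "x \<in> U"
      moreover obtain n where "\<forall>y\<in>X. agree n x y \<longrightarrow> y \<in> U" using r \<open>x \<in> U\<close> by blast
      ultimately show "x \<in> V \<inter> X" using r X unfolding V_def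
        by (auto intro!: bexI[of _ x] exI[of _ n])
    qed
    show "V \<inter> X \<subseteq> U" by (auto simp: V_def)
  qed
  ultimately show ?l by (auto simp: subshift_topology_def openin_subtopology)
qed

lemma topspace_subshift_topology:
  "X \<subseteq> {x. \<forall>i. x i \<in> A} \<Longrightarrow> topspace (subshift_topology A X) = X"
  by (auto simp: subshift_topology_def)

lemma Hausdorff_subshift_topology: "Hausdorff_space (subshift_topology A X)"
  unfolding subshift_topology_def
  by (intro Hausdorff_space_subtopology) (simp add: Hausdorff_space_product_topology Hausdorff_space_discrete_topology)

lemma continuous_map_subshift:
  assumes X: "X \<subseteq> {x. \<forall>i. x i \<in> A}" and Y: "Y \<subseteq> {x. \<forall>i. x i \<in> B}"
    and f: "\<And>x. x \<in> X \<Longrightarrow> f x \<in> Y"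
    and c: "\<And>n. \<exists>m. \<forall>x\<in>X. \<forall>y\<in>X. agree m x y \<longrightarrow> agree n (f x) (f y)"
  shows "continuous_map (subshift_topology A X) (subshift_topology B Y) f"
  unfolding continuous_map_def
proof (intro conjI allI impI)
  show "f \<in> topspace (subshift_topology A X) \<rightarrow> topspace (subshift_topology B Y)"
    using f by (auto simp: topspace_subshift_topology X Y)
  fix U assume U: "openin (subshift_topology B Y) U"
  show "openin (subshift_topology A X) {x \<in> topspace (subshift_topology A X). f x \<in> U}"
    unfolding topspace_subshift_topology[OF X] openin_subshift_topology[OF X]
  proof (intro conjI ballI)
    fix x assume x: "x \<in> {x \<in> X. f x \<in> U}"
    with U obtain n where n: "\<And>y. y \<in> Y \<Longrightarrow> agree n (f x) y \<Longrightarrow> y \<in> U"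
      unfolding openin_subshift_topology[OF Y] by blast
    obtain m where "\<forall>x\<in>X. \<forall>y\<in>X. agree m x y \<longrightarrow> agree n (f x) (f y)" using c by blast
    then show "\<exists>n. \<forall>y\<in>X. agree n x y \<longrightarrow> y \<in> {x \<in> X. f x \<in> U}"
      using n f x by (intro exI[of _ m]) auto
  qed auto
qed

section \<open>Borel sets and a generating algebra\<close>

lemma measurable_continuous_map:
  assumes "continuous_map S T f"
  shows "f \<in> measurable (borel_sigma S) (borel_sigma T)"
  unfolding borel_sigma_def
proof (rule measurable_measure_of)
  show "{U. openin T U} \<subseteq> Pow (topspace T)" by (auto dest: openin_subset)
  show "f \<in> space (sigma (topspace S) {U. openin S U}) \<rightarrow> topspace T"
    using assms by (auto simp: space_measure_of_conv continuous_map_def)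
  fix U assume "U \<in> {U. openin T U}"
  then have "openin S {x \<in> topspace S. f x \<in> U}" using assms by (auto simp: continuous_map_def)
  then have "{x \<in> topspace S. f x \<in> U} \<in> sigma_sets (topspace S) {U. openin S U}" by auto
  moreover have "f -` U \<inter> topspace S = {x \<in> topspace S. f x \<in> U}" by auto
  ultimately show "f -` U \<inter> space (sigma (topspace S) {U. openin S U}) \<in> sets (sigma (topspace S) {U. openin S U})"
    by (subst sets_measure_of) (auto simp: space_measure_of_conv dest: openin_subset)
qed

lemma space_borel_sigma [simp]: "space (borel_sigma T) = topspace T"
  by (simp add: borel_sigma_def space_measure_of_conv)

lemma sets_borel_sigma: "sets (borel_sigma T) = sigma_sets (topspace T) {U. openin T U}"
  unfolding borel_sigma_def by (rule sets_measure_of) (auto dest: openin_subset)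

lemma closedin_in_borel_sigma:
  assumes "closedin T C" shows "C \<in> sets (borel_sigma T)"
proof -
  have "topspace T - (topspace T - C) \<in> sigma_sets (topspace T) {U. openin T U}"
    using assms by (intro sigma_sets.Compl sigma_sets.Basic) (auto simp: closedin_def)
  moreover have "topspace T - (topspace T - C) = C" using assms closedin_subset by fastforce
  ultimately show ?thesis by (simp add: sets_borel_sigma)
qed

text \<open>Unlike for open sets, one \<open>n\<close> serves all points of \<open>B\<close>, which
  makes these sets clopen. Over a finite alphabet they are the finite unions of cylinders.\<close>

definition window_sets :: "(int \<Rightarrow> 'a) set \<Rightarrow> (int \<Rightarrow> 'a) set set" where
  "window_sets X = {B. B \<subseteq> X \<and> (\<exists>n. \<forall>x\<in>B. \<forall>y\<in>X. agree n x y \<longrightarrow> y \<in> B)}"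

lemma window_setsI:
  "B \<subseteq> X \<Longrightarrow> (\<And>x y. x \<in> B \<Longrightarrow> y \<in> X \<Longrightarrow> agree n x y \<Longrightarrow> y \<in> B) \<Longrightarrow> B \<in> window_sets X"
  unfolding window_sets_def by blast

lemma window_setsE:
  assumes "B \<in> window_sets X"
  obtains n where "\<And>x y m. x \<in> B \<Longrightarrow> y \<in> X \<Longrightarrow> n \<le> m \<Longrightarrow> agree m x y \<Longrightarrow> y \<in> B" "B \<subseteq> X"
  using assms unfolding window_sets_def by (blast intro: agree_mono)

lemma algebra_window_sets: "algebra X (window_sets X)"
  unfolding algebra_iff_Un
proof (intro conjI ballI)
  show "window_sets X \<subseteq> Pow X" by (auto simp: window_sets_def)
  show "{} \<in> window_sets X" by (auto simp: window_sets_def)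
  fix B assume "B \<in> window_sets X"
  then obtain n where n: "\<And>x y m. x \<in> B \<Longrightarrow> y \<in> X \<Longrightarrow> n \<le> m \<Longrightarrow> agree m x y \<Longrightarrow> y \<in> B" "B \<subseteq> X"
    by (elim window_setsE) blast
  show "X - B \<in> window_sets X"
    by (rule window_setsI[of _ _ n]) (use n agree_sym in blast)+
  fix C assume "C \<in> window_sets X"
  then obtain k where k: "\<And>x y m. x \<in> C \<Longrightarrow> y \<in> X \<Longrightarrow> k \<le> m \<Longrightarrow> agree m x y \<Longrightarrow> y \<in> C" "C \<subseteq> X"
    by (elim window_setsE) blast
  show "B \<union> C \<in> window_sets X"
  proof (rule window_setsI[of _ _ "max n k"])
    fix x y assume "x \<in> B \<union> C" "y \<in> X" "agree (max n k) x y"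
    then show "y \<in> B \<union> C" using n(1)[of x y "max n k"] k(1)[of x y "max n k"] by auto
  qed (use n k in auto)
qed

lemma whole_in_window_sets [simp]: "X \<in> window_sets X"
  by (rule window_setsI) auto

lemma window_set_open:
  "X \<subseteq> {x. \<forall>i. x i \<in> A} \<Longrightarrow> B \<in> window_sets X \<Longrightarrow> openin (subshift_topology A X) B"
  unfolding openin_subshift_topology by (elim window_setsE) (blast intro: order_refl)

lemma window_set_closed:
  assumes "X \<subseteq> {x. \<forall>i. x i \<in> A}" "B \<in> window_sets X"
  shows "closedin (subshift_topology A X) B"
proof -
  interpret algebra X "window_sets X" by (rule algebra_window_sets)
  have "X - B \<in> window_sets X" using assms by auto
  then show ?thesis using assms window_set_open[OF assms(1)] sets_into_space
    by (auto simp: closedin_def topspace_subshift_topology)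
qed

lemma sets_borel_subshift:
  assumes X: "X \<subseteq> {x. \<forall>i. x i \<in> A}"
  shows "sets (borel_sigma (subshift_topology A X)) = sigma_sets X (window_sets X)"
  unfolding sets_borel_sigma topspace_subshift_topology[OF X]
proof (rule sigma_sets_eqI)
  fix U assume "U \<in> {U. openin (subshift_topology A X) U}"
  then have U: "U \<subseteq> X" "\<And>x. x \<in> U \<Longrightarrow> \<exists>n. \<forall>y\<in>X. agree n x y \<longrightarrow> y \<in> U"
    unfolding mem_Collect_eq openin_subshift_topology[OF X] by auto
  \<comment> \<open>The points whose \<open>n\<close>-window already forces membership in
    \<open>U\<close>: an open set is the countable union of these window sets.\<close>
  define V where "V n = {x\<in>X. \<forall>y\<in>X. agree n x y \<longrightarrow> y \<in> U}" for n
  have "V n \<in> window_sets X" for n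
    unfolding V_def by (rule window_setsI[of _ _ n]) (auto intro: agree_trans)
  moreover have "U = (\<Union>n. V n)" using U unfolding V_def by fastforce
  ultimately show "U \<in> sigma_sets X (window_sets X)" by (auto intro!: sigma_sets.Union)
qed (use window_set_open[OF X] in auto)

lemma measure_eq_on_window_sets:
  assumes X: "X \<subseteq> {x. \<forall>i. x i \<in> A}"
    and \<mu>: "sets \<mu> = sets (borel_sigma (subshift_topology A X))" "prob_space \<mu>"
    and \<nu>: "sets \<nu> = sets (borel_sigma (subshift_topology A X))"
    and eq: "\<And>B. B \<in> window_sets X \<Longrightarrow> emeasure \<mu> B = emeasure \<nu> B"
  shows "\<mu> = \<nu>"
proof (rule measure_eqI_generator_eq)
  interpret algebra X "window_sets X" by (rule algebra_window_sets)
  show "Int_stable (window_sets X)" by (auto simp: Int_stable_def)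
  show "window_sets X \<subseteq> Pow X" by (rule space_closed)
  show "sets \<mu> = sigma_sets X (window_sets X)" "sets \<nu> = sigma_sets X (window_sets X)"
    using \<mu> \<nu> sets_borel_subshift[OF X] by auto
  show "range (\<lambda>_::nat. X) \<subseteq> window_sets X" by auto
  show "emeasure \<mu> X \<noteq> \<infinity>" 
    using \<mu>(2) finite_measure.emeasure_finite[of \<mu>] prob_space.axioms(1) by (auto simp: infinity_ennreal_def)
qed (use eq in auto)

text \<open>The level subshifts with an arbitrary set of words in place of the language. The case
  \<open>L = UNIV\<close> is the full shift, where periodic points outside the subshift can
  live.\<close>

definition word_subshift :: "'a set \<Rightarrow> 'a list set \<Rightarrow> (int \<Rightarrow> 'a) set" where
  "word_subshift A L = {y. (\<forall>i. y i \<in> A) \<and> (\<forall>i j. map y [i..j] \<in> L)}"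

lemma word_subshift_subset: "word_subshift A L \<subseteq> {x. \<forall>i. x i \<in> A}"
  by (auto simp: word_subshift_def)

text \<open>Each word condition concerns a single window, so the subshift is closed in the full
  shift, which is compact by Tychonoff.\<close>

lemma compact_subshift_topology:
  assumes "finite A"
  shows "compact_space (subshift_topology A (word_subshift A L))"
proof -
  let ?T = "product_topology (\<lambda>_::int. discrete_topology A) UNIV"
  have c: "compact_space ?T"
    using assms by (simp add: compact_space_product_topology compact_space_discrete_topology)
  let ?Y = "{x. \<forall>i::int. x i \<in> A}"
  have T: "?T = subshift_topology A ?Y"
    unfolding subshift_topology_def by (subst subtopology_superset) auto
  have "openin ?T (?Y - word_subshift A L)"
    unfolding T openin_subshift_topology[OF order_refl]
  proof (intro conjI ballI)
    fix x assume x: "x \<in> ?Y - word_subshift A L"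
    then obtain i j where ij: "map x [i..j] \<notin> L" by (auto simp: word_subshift_def)
    have "map x [i..j] = map y [i..j]" if "agree (nat \<bar>i\<bar> + nat \<bar>j\<bar>) x y" for y
      using that by (rule agree_map_eq) auto
    then show "\<exists>n. \<forall>y\<in>?Y. agree n x y \<longrightarrow> y \<in> ?Y - word_subshift A L"
      using ij by (intro exI[of _ "nat \<bar>i\<bar> + nat \<bar>j\<bar>"]) (force simp: word_subshift_def simp del: map_eq_conv)
  qed auto
  then have "closedin ?T (word_subshift A L)"
    by (auto simp: closedin_def word_subshift_def T topspace_subshift_topology)
  then show ?thesis using c unfolding subshift_topology_def
    by (simp add: closedin_compact_space compact_space_subtopology)
qed

section \<open>The shift map and its invariant probabilities\<close>

lemma bi_shift_funpow: "(bi_shift ^^ k) x = (\<lambda>i. x (i + int k))"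
  by (induction k) (auto simp: bi_shift_def algebra_simps)

lemma bi_shift_word_subshift:
  assumes "x \<in> word_subshift A L" shows "(bi_shift ^^ k) x \<in> word_subshift A L"
proof -
  have "map ((bi_shift ^^ k) x) [i..j] = map x [i + int k..j + int k]" for i j
    by (rule nth_equalityI) (auto simp: bi_shift_funpow algebra_simps)
  then show ?thesis using assms by (auto simp: word_subshift_def bi_shift_funpow)
qed

lemma continuous_bi_shift:
  "continuous_map (subshift_topology A (word_subshift A L)) (subshift_topology A (word_subshift A L)) (bi_shift ^^ k)"
proof (rule continuous_map_subshift[OF word_subshift_subset word_subshift_subset])
  fix n
  show "\<exists>m. \<forall>x\<in>word_subshift A L. \<forall>y\<in>word_subshift A L. agree m x y \<longrightarrow>
      agree n ((bi_shift ^^ k) x) ((bi_shift ^^ k) y)"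
    by (intro exI[of _ "n + k"]) (auto simp: agree_def bi_shift_funpow)
qed (rule bi_shift_word_subshift)

lemma invariant_probability_funpow:
  assumes \<mu>: "invariant_probability (subshift_topology A (word_subshift A L)) bi_shift \<mu>"
    and B: "B \<in> sets \<mu>"
  shows "emeasure \<mu> ((bi_shift ^^ k) -` B \<inter> space \<mu>) = emeasure \<mu> B"
    and "(bi_shift ^^ k) -` B \<inter> space \<mu> \<in> sets \<mu>"
proof -
  have s: "sets \<mu> = sets (borel_sigma (subshift_topology A (word_subshift A L)))"
    using \<mu> by (simp add: invariant_probability_def)
  have sp: "space \<mu> = word_subshift A L"
    using sets_eq_imp_space_eq[OF s] by (simp add: topspace_subshift_topology[OF word_subshift_subset])
  have inv: "emeasure \<mu> (bi_shift -` C \<inter> space \<mu>) = emeasure \<mu> C" if "C \<in> sets \<mu>" for C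
    using \<mu> that unfolding invariant_probability_def by blast
  have m: "(bi_shift ^^ k) \<in> measurable \<mu> \<mu>" for k
    using measurable_continuous_map[OF continuous_bi_shift[of A L k]] measurable_cong_sets[OF s s] by simp
  show "(bi_shift ^^ k) -` B \<inter> space \<mu> \<in> sets \<mu>" using m B by (rule measurable_sets)
  show "emeasure \<mu> ((bi_shift ^^ k) -` B \<inter> space \<mu>) = emeasure \<mu> B"
  proof (induction k)
    case 0
    then show ?case using sets.sets_into_space[OF B] by (simp add: inf.absorb1)
  next
    case (Suc k)
    have "(bi_shift ^^ Suc k) -` B \<inter> space \<mu> = bi_shift -` ((bi_shift ^^ k) -` B \<inter> space \<mu>) \<inter> space \<mu>"
      using bi_shift_word_subshift[of _ A L 1] by (auto simp: sp funpow_swap1)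
    moreover have "(bi_shift ^^ k) -` B \<inter> space \<mu> \<in> sets \<mu>" using m B by (rule measurable_sets)
    ultimately show ?case using inv Suc by (simp only:)
  qed
qed

section \<open>Invariant measures from empirical frequencies\<close>

text \<open>Compactness of a product of unit intervals. The index type \<open>'c\<close> may be
  uncountable, so simultaneous convergence is obtained along a filter finer than
  \<open>sequentially\<close> instead of a subsequence.\<close>

lemma cluster_filter:
  fixes f :: "nat \<Rightarrow> 'c \<Rightarrow> real"
  assumes "\<And>N c. 0 \<le> f N c \<and> f N c \<le> 1"
  obtains G g where "G \<noteq> bot" "G \<le> sequentially" "\<And>c. ((\<lambda>N. f N c) \<longlongrightarrow> g c) G"
proof -
  let ?K = "PiE UNIV (\<lambda>_. {0..1}) :: ('c \<Rightarrow> real) set"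
  have "compactin (product_topology (\<lambda>_. euclidean) UNIV) ?K" by (simp add: compactin_PiE)
  then have "compact ?K" by (simp add: euclidean_product_topology)
  moreover have "filtermap f sequentially \<noteq> bot" by (simp add: filtermap_bot_iff)
  moreover have "eventually (\<lambda>z. z \<in> ?K) (filtermap f sequentially)"
    using assms by (auto simp: eventually_filtermap intro!: always_eventually)
  ultimately obtain g where g: "inf (nhds g) (filtermap f sequentially) \<noteq> bot"
    unfolding compact_filter by blast
  \<comment> \<open>The indices \<open>N\<close> at which \<open>f N\<close> is close to
    \<open>g\<close>; that \<open>g\<close> is a cluster point makes this filter proper.\<close>
  define G where "G = inf sequentially (filtercomap f (nhds g))"
  have "G \<noteq> bot"
  proof
    assume "G = bot"
    then obtain P Q where PQ: "eventually P sequentially" "eventually Q (nhds g)" "\<And>N. P N \<Longrightarrow> Q (f N) \<Longrightarrow> False"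
      unfolding trivial_limit_def G_def eventually_inf eventually_filtercomap by metis
    have "eventually (\<lambda>z. \<exists>N. P N \<and> z = f N) (filtermap f sequentially)"
      using PQ(1) by (auto simp: eventually_filtermap elim: eventually_mono)
    then have "eventually (\<lambda>_. False) (inf (nhds g) (filtermap f sequentially))"
      unfolding eventually_inf using PQ by blast
    then show False using g by (simp add: trivial_limit_def)
  qed
  moreover have "G \<le> sequentially" by (simp add: G_def)
  moreover have "((\<lambda>N. f N c) \<longlongrightarrow> g c) G" for c
  proof -
    have f: "filterlim f (nhds g) G"
      unfolding G_def by (metis filterlim_filtercomap filterlim_mono inf_le2 order_refl)
    have "((\<lambda>z::'c \<Rightarrow> real. z c) \<longlongrightarrow> g c) (nhds g)"
    proof (rule topological_tendstoI)
      fix S assume "open S" "g c \<in> S"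
      then show "eventually (\<lambda>z. z c \<in> S) (nhds g)"
        unfolding eventually_nhds
        by (intro exI[of _ "(\<lambda>z. z c) -` S"]) (auto intro!: open_vimage continuous_on_product_coordinates)
    qed
    from filterlim_compose[OF this f] show ?thesis .
  qed
  ultimately show ?thesis using that by blast
qed

text \<open>The mass of \<open>B\<close> under the empirical measure of an orbit segment. Being
  defined for every set, measurable or not, it allows one limit over all sets at once; for
  \<open>h = 0\<close> its value is \<open>0\<close>, so it always lies in the unit
  interval.\<close>

definition orbit_frequency :: "(int \<Rightarrow> 'a) \<Rightarrow> nat \<Rightarrow> (int \<Rightarrow> 'a) set \<Rightarrow> real" where
  "orbit_frequency x h B = (\<Sum>k<h. of_bool ((bi_shift ^^ k) x \<in> B)) / real h"

lemma orbit_frequency_bounds: "0 \<le> orbit_frequency x h B \<and> orbit_frequency x h B \<le> 1"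
proof -
  have "(\<Sum>k<h. of_bool ((bi_shift ^^ k) x \<in> B) :: real) \<le> (\<Sum>k<h. 1)" by (intro sum_mono) auto
  then show ?thesis unfolding orbit_frequency_def by (auto simp: divide_le_eq intro!: sum_nonneg divide_nonneg_nonneg)
qed

lemma orbit_frequency_Un:
  "B \<inter> C = {} \<Longrightarrow> orbit_frequency x h (B \<union> C) = orbit_frequency x h B + orbit_frequency x h C"
  unfolding orbit_frequency_def add_divide_distrib[symmetric] sum.distrib[symmetric]
  by (intro arg_cong2[where f = "(/)"] sum.cong) auto

lemma orbit_frequency_eq_1:
  "h > 0 \<Longrightarrow> (\<And>k. k < h \<Longrightarrow> (bi_shift ^^ k) x \<in> B) \<Longrightarrow> orbit_frequency x h B = 1"
  by (simp add: orbit_frequency_def)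

text \<open>On a periodic orbit the shift permutes the summands cyclically, so invariance is exact
  and not merely asymptotic.\<close>

lemma orbit_frequency_bi_shift:
  assumes "(bi_shift ^^ h) x = x"
  shows "orbit_frequency x h (bi_shift -` B) = orbit_frequency x h B"
proof -
  let ?f = "\<lambda>k. of_bool ((bi_shift ^^ k) x \<in> B) :: real"
  have "(\<Sum>k<h. ?f (Suc k)) = (\<Sum>k<h. ?f k)"
    using sum.lessThan_Suc_shift[of ?f h] assms by simp
  then show ?thesis by (simp add: orbit_frequency_def)
qed

lemma orbit_frequency_le:
  assumes "\<And>k. k < h \<Longrightarrow> (bi_shift ^^ k) x \<in> B \<Longrightarrow> k \<in> K" "finite K"
  shows "orbit_frequency x h B \<le> real (card K) / real h"
proof -
  have "(\<Sum>k<h. of_bool ((bi_shift ^^ k) x \<in> B) :: real) = real (card {k. k < h \<and> (bi_shift ^^ k) x \<in> B})"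
    by (simp add: of_bool_def sum.If_cases Int_def lessThan_def)
  moreover have "card {k. k < h \<and> (bi_shift ^^ k) x \<in> B} \<le> card K"
    using assms by (intro card_mono) auto
  ultimately show ?thesis unfolding orbit_frequency_def by (simp add: divide_right_mono)
qed

lemma sublist_map_nth_upto:
  assumes "0 \<le> i" "j < int (length w)"
  shows "sublist (map (\<lambda>k. w ! nat k) [i..j]) w"
proof -
  have "map (\<lambda>k. w ! nat k) [i..j] = take (nat (j - i + 1)) (drop (nat i) w)"
    using assms by (intro nth_equalityI) (auto simp: nat_add_distrib)
  then show ?thesis by (metis append_take_drop_id sublist_appendI append.assoc)
qed

text \<open>The periodic repetitions \<open>x N\<close> of \<open>W N\<close> have invariant
  frequencies but need not lie in the subshift. Their limit is therefore built as a measure on the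
  full shift; since only boundedly many windows cross the seam between two periods, it is carried by
  the subshift.\<close>

lemma empirical_limit:
  fixes W :: "nat \<Rightarrow> 'a list"
  assumes A: "finite A" and WA: "\<And>N. set (W N) \<subseteq> A"
    and WL: "\<And>N w. sublist w (W N) \<Longrightarrow> w \<in> L"
    and len: "filterlim (\<lambda>N. length (W N)) at_top sequentially"
  obtains G \<nu> where "G \<noteq> bot" "G \<le> sequentially"
    "invariant_probability (subshift_topology A (word_subshift A L)) bi_shift \<nu>"
    "\<And>a. ((\<lambda>N. real (count_list (W N) a) / real (length (W N))) \<longlongrightarrow>
          measure \<nu> {x \<in> word_subshift A L. x 0 = a}) G"
proof -
  define h where "h N = length (W N)" for N
  define x where "x N = (\<lambda>i. W N ! nat (i mod int (h N)))" for N
  have per: "(bi_shift ^^ h N) (x N) = x N" for N by (simp add: bi_shift_funpow x_def)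
  have xA: "x N i \<in> A" if "h N > 0" for N i
  proof -
    have "nat (i mod int (h N)) < length (W N)" using that by (simp add: h_def nat_less_iff)
    then show ?thesis using WA[of N] nth_mem unfolding x_def by blast
  qed
  obtain G g where G: "G \<noteq> bot" "G \<le> sequentially"
    and g: "\<And>B. ((\<lambda>N. orbit_frequency (x N) (h N) B) \<longlongrightarrow> g B) G"
    using cluster_filter[of "\<lambda>N. orbit_frequency (x N) (h N)"] orbit_frequency_bounds by blast
  have hG: "filterlim (\<lambda>N. real (h N)) at_top G"
    unfolding h_def by (rule filterlim_mono[OF filterlim_compose[OF filterlim_real_sequentially len] order_refl G(2)])
  have hpos: "eventually (\<lambda>N. h N > 0) G"
    using hG unfolding filterlim_at_top_dense by (metis (mono_tags, lifting) eventually_mono of_nat_0_less_iff)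
  have g0: "0 \<le> g B" for B
    by (rule tendsto_lowerbound[OF g]) (auto simp: orbit_frequency_bounds G)
  have g_Un: "g (B \<union> C) = g B + g C" if "B \<inter> C = {}" for B C
    using tendsto_add[OF g[of B] g[of C]] g[of "B \<union> C"] that G
    by (simp add: orbit_frequency_Un tendsto_unique)
  have g_shift: "g (bi_shift -` B) = g B" for B
    using g[of "bi_shift -` B"] g[of B] G by (simp add: orbit_frequency_bi_shift[OF per] tendsto_unique)
  let ?Y = "word_subshift A UNIV" and ?X = "word_subshift A L"
  let ?S = "subshift_topology A ?Y" and ?T = "subshift_topology A ?X"
  have XY: "?X \<subseteq> ?Y" by (auto simp: word_subshift_def)
  note Y = word_subshift_subset[of A UNIV] note X = word_subshift_subset[of A L]
  have g1: "g B = 1" if "?Y \<subseteq> B" for B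
  proof (rule tendsto_unique[OF G(1) g])
    have "eventually (\<lambda>N. orbit_frequency (x N) (h N) B = 1) G"
      using hpos
    proof eventually_elim
      case (elim N)
      show ?case using that elim xA
        by (intro orbit_frequency_eq_1) (auto simp: word_subshift_def bi_shift_funpow)
    qed
    then show "((\<lambda>N. orbit_frequency (x N) (h N) B) \<longlongrightarrow> 1) G" by (rule tendsto_eventually)
  qed
  have g_empty: "g {} = 0" using g_Un[of "{}" "{}"] by simp
  \<comment> \<open>\<open>g\<close> is defined on sets of arbitrary functions; those with letters
    outside \<open>A\<close> have limit frequency \<open>0\<close>.\<close>
  have g_Y: "g (B \<inter> ?Y) = g B" for B
  proof -
    have "g ((B \<inter> ?Y) \<union> (B - ?Y)) = g (B \<inter> ?Y) + g (B - ?Y)" by (rule g_Un) blast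
    moreover have "(B \<inter> ?Y) \<union> (B - ?Y) = B" by blast
    moreover have "g (- ?Y) = 0" using g_Un[of "?Y" "- ?Y"] g1[of ?Y] g1[of UNIV] by simp
    moreover have "- ?Y = (B - ?Y) \<union> (- B - ?Y)" by blast
    moreover have "g ((B - ?Y) \<union> (- B - ?Y)) = g (B - ?Y) + g (- B - ?Y)" by (rule g_Un) blast
    ultimately show ?thesis using g0[of "B - ?Y"] g0[of "- B - ?Y"] by simp
  qed
  have g_word: "g {x. map x [i..j] \<notin> L} = 0" for i j
  proof -
    have bnd: "orbit_frequency (x N) (h N) {x. map x [i..j] \<notin> L} \<le> real (nat \<bar>i\<bar> + nat \<bar>j\<bar>) / real (h N)" for N
    proof -
      \<comment> \<open>The shifts \<open>k\<close> for which the window from \<open>i + k\<close>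
        to \<open>j + k\<close> may stick out of \<open>W N\<close> on the left or on the right. For
        all others it reads a factor of \<open>W N\<close>, hence a word of \<open>L\<close>. The
        bound on their number does not depend on \<open>N\<close>.\<close>
      let ?K = "{..<nat \<bar>i\<bar>} \<union> {h N - nat \<bar>j\<bar>..<h N}"
      have "k \<in> ?K" if k: "k < h N" and bad: "(bi_shift ^^ k) (x N) \<in> {x. map x [i..j] \<notin> L}" for k
      proof (rule ccontr)
        assume "k \<notin> ?K"
        then have b: "0 \<le> i + int k" "j + int k < int (h N)" using k by auto
        have "map ((bi_shift ^^ k) (x N)) [i..j] = map (\<lambda>k. W N ! nat k) [i + int k..j + int k]"
          using b by (intro nth_equalityI) (auto simp: bi_shift_funpow x_def algebra_simps mod_pos_pos_trivial)
        also have "sublist \<dots> (W N)" using b by (intro sublist_map_nth_upto) (auto simp: h_def)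
        finally show False using WL bad by auto
      qed
      then have "orbit_frequency (x N) (h N) {x. map x [i..j] \<notin> L} \<le> real (card ?K) / real (h N)"
        by (intro orbit_frequency_le) auto
      also have "card ?K \<le> nat \<bar>i\<bar> + nat \<bar>j\<bar>" by (rule order_trans[OF card_Un_le]) (simp; linarith)
      finally show ?thesis by (simp add: divide_right_mono order_trans)
    qed
    have lim: "((\<lambda>N. real (nat \<bar>i\<bar> + nat \<bar>j\<bar>) / real (h N)) \<longlongrightarrow> 0) G"
      by (rule tendsto_divide_0[OF tendsto_const]) (rule filterlim_at_top_imp_at_infinity[OF hG])
    have "((\<lambda>N. orbit_frequency (x N) (h N) {x. map x [i..j] \<notin> L}) \<longlongrightarrow> 0) G"
      by (rule tendsto_sandwich[OF always_eventually always_eventually tendsto_const lim])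
         (rule allI, simp only: orbit_frequency_bounds bnd)+
    then show ?thesis by (rule tendsto_unique[OF G(1) g])
  qed
  interpret algebra ?Y "window_sets ?Y" by (rule algebra_window_sets)
  have "\<exists>\<mu> :: (int \<Rightarrow> 'a) set \<Rightarrow> ennreal. (\<forall>s \<in> window_sets ?Y. \<mu> s = ennreal (g s)) \<and>
      measure_space ?Y (sigma_sets ?Y (window_sets ?Y)) \<mu>"
  proof (rule caratheodory_empty_continuous)
    show "positive (window_sets ?Y) (\<lambda>s. ennreal (g s))" by (simp add: positive_def g_empty)
    show "additive (window_sets ?Y) (\<lambda>s. ennreal (g s))" by (auto simp: additive_def g_Un g0 ennreal_plus)
    fix B :: "nat \<Rightarrow> _" assume B: "range B \<subseteq> window_sets ?Y" "decseq B" "(\<Inter>i. B i) = {}"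
    \<comment> \<open>Window sets are closed and the full shift is compact, so a decreasing sequence
      with empty intersection reaches the empty set. Continuity at the empty set follows, and
      Caratheodory extends the finitely additive \<open>g\<close>.\<close>
    have "\<exists>n. B n = {}"
    proof (rule ccontr)
      assume "\<nexists>n. B n = {}"
      then have "(\<Inter>n. B n) \<noteq> {}"
        using B by (intro compact_space_imp_nest[OF compact_subshift_topology[OF A, of UNIV]]
            window_set_closed[OF Y]) auto
      then show False using B(3) by blast
    qed
    then obtain n where n: "B n = {}" by blast
    have "eventually (\<lambda>i. ennreal (g (B i)) = 0) sequentially"
      using eventually_ge_at_top[of n]
    proof eventually_elim
      case (elim i)
      then have "B i = {}" using B(2) n by (auto simp: decseq_def)
      then show ?case by (simp add: g_empty)
    qed
    then show "(\<lambda>i. ennreal (g (B i))) \<longlonglongrightarrow> 0" by (rule tendsto_eventually)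
  qed auto
  then obtain m where m: "\<And>s. s \<in> window_sets ?Y \<Longrightarrow> m s = ennreal (g s)"
    "measure_space ?Y (sigma_sets ?Y (window_sets ?Y)) m" by blast
  define \<mu> where "\<mu> = measure_of ?Y (window_sets ?Y) m"
  have sets_\<mu>: "sets \<mu> = sigma_sets ?Y (window_sets ?Y)"
    unfolding \<mu>_def using space_closed by (rule sets_measure_of)
  have space_\<mu>: "space \<mu> = ?Y" unfolding \<mu>_def using space_closed by (rule space_measure_of)
  have em: "emeasure \<mu> B = ennreal (g B)" if "B \<in> window_sets ?Y" for B
    using that m(2) space_closed unfolding measure_space_def
    by (subst emeasure_measure_of[OF \<mu>_def]) (auto simp: sets_\<mu> m(1))
  interpret \<mu>: prob_space \<mu>
    by rule (simp add: space_\<mu> em g1)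
  have word_window: "{x \<in> ?Y. P (map x [i..j])} \<in> window_sets ?Y" for P i j
  proof (rule window_setsI[of _ _ "nat \<bar>i\<bar> + nat \<bar>j\<bar>"])
    fix x y assume "x \<in> {x \<in> ?Y. P (map x [i..j])}" "y \<in> ?Y" "agree (nat \<bar>i\<bar> + nat \<bar>j\<bar>) x y"
    moreover from this have "map x [i..j] = map y [i..j]" by (intro agree_map_eq) auto
    ultimately show "y \<in> {x \<in> ?Y. P (map x [i..j])}" by (simp del: map_eq_conv)
  qed auto
  \<comment> \<open>Only countably many pairs \<open>i\<close>, \<open>j\<close> occur, so the
    subshift is measurable, and of full measure as soon as each single word condition is.\<close>
  have Xeq: "?X = (\<Inter>i. \<Inter>j. {x \<in> ?Y. map x [i..j] \<in> L})" by (auto simp: word_subshift_def)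
  have words: "{x \<in> ?Y. map x [i..j] \<in> L} \<in> sets \<mu>" for i j
    unfolding sets_\<mu> by (rule sigma_sets.Basic, rule word_window)
  then have X_meas: "?X \<in> sets \<mu>" unfolding Xeq
    by (intro sets.countable_INT image_subsetI words UNIV_not_empty)
  have "AE x in \<mu>. map x [i..j] \<in> L" for i j
  proof (rule AE_I)
    show "{x \<in> space \<mu>. \<not> map x [i..j] \<in> L} \<subseteq> {x \<in> ?Y. map x [i..j] \<notin> L}" by (simp add: space_\<mu>)
    have w: "{x \<in> ?Y. map x [i..j] \<notin> L} \<in> window_sets ?Y" by (rule word_window)
    then show "{x \<in> ?Y. map x [i..j] \<notin> L} \<in> sets \<mu>" unfolding sets_\<mu> by (rule sigma_sets.Basic)
    have "{x \<in> ?Y. map x [i..j] \<notin> L} = {x. map x [i..j] \<notin> L} \<inter> ?Y" by blast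
    then show "emeasure \<mu> {x \<in> ?Y. map x [i..j] \<notin> L} = 0"
      using em[OF w] g_Y g_word by simp
  qed
  then have "AE x in \<mu>. \<forall>i j. map x [i..j] \<in> L" by (simp add: AE_all_countable)
  then have AEX: "AE x in \<mu>. x \<in> ?X" by (rule AE_mp) (auto simp: space_\<mu> word_subshift_def intro!: AE_I2)
  \<comment> \<open>Restriction makes the subshift the underlying space; the trace of the Borel sets
    of the full shift is the Borel structure of the subspace.\<close>
  define \<nu> where "\<nu> = restrict_space \<mu> ?X"
  have sets_\<nu>: "sets \<nu> = sets (borel_sigma ?T)"
  proof -
    have eq: "sets \<mu> = sigma_sets ?Y {U. openin ?S U}"
      using sets_borel_sigma[of ?S] unfolding sets_\<mu> topspace_subshift_topology[OF Y] sets_borel_subshift[OF Y] .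
    have "sets \<nu> = sigma_sets ?X ((\<inter>) ?X ` {U. openin ?S U})"
      using X_meas XY unfolding \<nu>_def sets_restrict_space eq by (rule sigma_sets_Int)
    moreover have "(\<inter>) ?X ` {U. openin ?S U} = {U. openin ?T U}"
    proof -
      have "?T = subtopology ?S ?X"
        using XY by (simp add: subshift_topology_def subtopology_subtopology inf.absorb2)
      then show ?thesis by (auto simp: openin_subtopology)
    qed
    ultimately show ?thesis by (simp add: sets_borel_sigma topspace_subshift_topology[OF X])
  qed
  have em_\<nu>: "emeasure \<nu> (B \<inter> ?X) = ennreal (g B)" if B: "B \<in> window_sets ?Y" for B
  proof -
    have Bs: "B \<in> sets \<mu>" unfolding sets_\<mu> using B by blast
    have "emeasure \<nu> (B \<inter> ?X) = emeasure \<mu> (B \<inter> ?X)"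
      unfolding \<nu>_def using X_meas by (intro emeasure_restrict_space) auto
    also have "\<dots> = emeasure \<mu> B" using AEX Bs X_meas by (intro emeasure_eq_AE) auto
    finally show ?thesis using em[OF B] by simp
  qed
  have space_\<nu>: "space \<nu> = ?X" using sets_eq_imp_space_eq[OF sets_\<nu>] by (simp add: topspace_subshift_topology[OF X])
  have "invariant_probability ?T bi_shift \<nu>"
    unfolding invariant_probability_def
  proof (intro conjI sets_\<nu>)
    have "emeasure \<nu> (?Y \<inter> ?X) = 1" using em_\<nu>[OF whole_in_window_sets] g1 by simp
    moreover have "?Y \<inter> ?X = ?X" by (auto simp: word_subshift_def)
    ultimately show "prob_space \<nu>" using space_\<nu> by (simp add: prob_spaceI)
    have meas: "bi_shift \<in> measurable \<nu> \<nu>"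
      using measurable_continuous_map[OF continuous_bi_shift[of A L 1]] measurable_cong_sets[OF sets_\<nu> sets_\<nu>] by simp
    have "distr \<nu> \<nu> bi_shift = \<nu>"
    proof (rule measure_eq_on_window_sets[OF X])
      show "prob_space (distr \<nu> \<nu> bi_shift)" using \<open>prob_space \<nu>\<close> meas by (rule prob_space.prob_space_distr)
      fix B assume B: "B \<in> window_sets ?X"
      then obtain n where n: "\<And>x y m. x \<in> B \<Longrightarrow> y \<in> ?X \<Longrightarrow> n \<le> m \<Longrightarrow> agree m x y \<Longrightarrow> y \<in> B" "B \<subseteq> ?X"
        by (elim window_setsE) blast
      \<comment> \<open>The values of \<open>\<nu>\<close> are known through \<open>g\<close> only
        on traces of window sets of the full shift, so \<open>B\<close> is written as such a
        trace.\<close>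
      define C where "C = {y \<in> ?Y. \<exists>x\<in>B. agree n x y}"
      have C: "C \<in> window_sets ?Y" unfolding C_def by (rule window_setsI[of _ _ n]) (auto intro: agree_trans)
      have BC: "B = C \<inter> ?X"
        using n(2) XY n(1)[OF _ _ order_refl] agree_refl unfolding C_def by blast
      have SC: "bi_shift -` C \<inter> ?Y \<in> window_sets ?Y"
      proof (rule window_setsI[of _ _ "n + 1"])
        fix x y assume *: "x \<in> bi_shift -` C \<inter> ?Y" "y \<in> ?Y" "agree (n + 1) x y"
        then have "agree n (bi_shift x) (bi_shift y)" by (auto simp: agree_def bi_shift_def)
        then show "y \<in> bi_shift -` C \<inter> ?Y" using * 
          by (auto simp: C_def intro: agree_trans) (auto simp: word_subshift_def bi_shift_def)
      qed auto
      have "emeasure (distr \<nu> \<nu> bi_shift) B = emeasure \<nu> (bi_shift -` B \<inter> ?X)"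
        using B meas sets_\<nu> sets_borel_subshift[OF X] by (subst emeasure_distr) (auto simp: space_\<nu>)
      also have "bi_shift -` B \<inter> ?X = (bi_shift -` C \<inter> ?Y) \<inter> ?X"
        unfolding BC using bi_shift_word_subshift[of _ A L 1] by (auto simp: word_subshift_def)
      also have "emeasure \<nu> \<dots> = ennreal (g C)" using em_\<nu>[OF SC] g_Y g_shift by simp
      also have "\<dots> = emeasure \<nu> B" using em_\<nu>[OF C] BC by simp
      finally show "emeasure (distr \<nu> \<nu> bi_shift) B = emeasure \<nu> B" .
    qed (use sets_\<nu> in auto)
    then show "\<forall>B\<in>sets \<nu>. emeasure \<nu> (bi_shift -` B \<inter> space \<nu>) = emeasure \<nu> B"
      using meas by (metis emeasure_distr)
  qed
  moreover have "((\<lambda>N. real (count_list (W N) a) / real (length (W N))) \<longlongrightarrow> measure \<nu> {x \<in> ?X. x 0 = a}) G" for a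
  proof -
    have "{x \<in> ?Y. x 0 = a} \<in> window_sets ?Y" by (rule window_setsI[of _ _ 0]) (auto simp: agree_def)
    then have "emeasure \<nu> ({x \<in> ?Y. x 0 = a} \<inter> ?X) = ennreal (g {x \<in> ?Y. x 0 = a})" by (rule em_\<nu>)
    moreover have "{x \<in> ?Y. x 0 = a} = {x. x 0 = a} \<inter> ?Y" by blast
    moreover have "{x \<in> ?Y. x 0 = a} \<inter> ?X = {x \<in> ?X. x 0 = a}" using XY by blast
    ultimately have "measure \<nu> {x \<in> ?X. x 0 = a} = g {x. x 0 = a}"
      by (simp add: g_Y measure_def g0)
    moreover have "orbit_frequency (x N) (h N) {x. x 0 = a} = real (count_list (W N) a) / real (length (W N))" for N
    proof -
      have "(\<Sum>k<h N. of_bool ((bi_shift ^^ k) (x N) \<in> {x. x 0 = a}) :: real) = (\<Sum>k<h N. of_bool (W N ! k = a))"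
        by (intro sum.cong) (auto simp: bi_shift_funpow x_def)
      also have "\<dots> = real (card {k. k < h N \<and> W N ! k = a})"
        by (simp add: of_bool_def sum.If_cases Int_def lessThan_def)
      also have "\<dots> = real (count_list (W N) a)"
        by (simp add: count_list_eq_length_filter length_filter_conv_card h_def eq_commute)
      finally show ?thesis by (simp add: orbit_frequency_def h_def)
    qed
    ultimately show ?thesis using g[of "{x. x 0 = a}"] by simp
  qed
  ultimately show ?thesis using that G by blast
qed

section \<open>Uniform morphisms and occurrences of words\<close>

lemma word_morphism_concat:
  assumes "word_morphism B A \<sigma>" "u \<in> lists B"
  shows "\<sigma> u = concat (map (\<lambda>b. \<sigma> [b]) u)"
  using assms(2)
proof (induction u rule: list.induct)
  case Nil
  then show ?case using assms(1) by (simp add: word_morphism_def)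
next
  case (Cons b u)
  then have "[b] \<in> lists B" "u \<in> lists B" by auto
  then have "\<sigma> ([b] @ u) = \<sigma> [b] @ \<sigma> u" using assms(1) unfolding word_morphism_def by blast
  then show ?case using Cons by simp
qed

lemma word_morphism_compose:
  assumes "word_morphism C B \<rho>" "word_morphism B A \<sigma>"
  shows "word_morphism C A (\<sigma> \<circ> \<rho>)"
  using assms unfolding word_morphism_def by simp

lemma word_morphism_in_lists: "word_morphism B A \<sigma> \<Longrightarrow> u \<in> lists B \<Longrightarrow> \<sigma> u \<in> lists A"
  unfolding word_morphism_def by blast

lemma length_concat_uniform:
  "(\<And>w. w \<in> set ws \<Longrightarrow> length w = l) \<Longrightarrow> length (concat ws) = l * length ws"
  by (induction ws) auto

lemma nth_concat_uniform:
  assumes "\<And>w. w \<in> set ws \<Longrightarrow> length w = l" "i < l * length ws"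
  shows "concat ws ! i = ws ! (i div l) ! (i mod l)"
  using assms
proof (induction ws arbitrary: i)
  case (Cons w ws)
  have w: "length w = l" using Cons.prems by simp
  have "l > 0" using Cons.prems(2) by (cases l) auto
  show ?case
  proof (cases "i < l")
    case True
    then show ?thesis using w by (simp add: nth_append)
  next
    case False
    then have "i - l < l * length ws" using Cons.prems(2) by auto
    then have "concat ws ! (i - l) = ws ! ((i - l) div l) ! ((i - l) mod l)"
      using Cons.prems(1) by (intro Cons.IH) auto
    then show ?thesis using False w \<open>l > 0\<close> by (simp add: nth_append le_div_geq le_mod_geq)
  qed
qed simp

lemma length_uniform_morphism:
  assumes "word_morphism B A \<sigma>" "\<And>b. b \<in> B \<Longrightarrow> length (\<sigma> [b]) = l" "u \<in> lists B"
  shows "length (\<sigma> u) = l * length u"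
proof -
  have "length (concat (map (\<lambda>b. \<sigma> [b]) u)) = l * length (map (\<lambda>b. \<sigma> [b]) u)"
    using assms(2,3) by (intro length_concat_uniform) auto
  then show ?thesis using word_morphism_concat[OF assms(1,3)] by simp
qed

lemma nth_uniform_morphism:
  assumes "word_morphism B A \<sigma>" "\<And>b. b \<in> B \<Longrightarrow> length (\<sigma> [b]) = l" "u \<in> lists B" "i < l * length u"
  shows "\<sigma> u ! i = \<sigma> [u ! (i div l)] ! (i mod l)"
proof -
  have "concat (map (\<lambda>b. \<sigma> [b]) u) ! i = map (\<lambda>b. \<sigma> [b]) u ! (i div l) ! (i mod l)"
    using assms(2,3,4) by (intro nth_concat_uniform) auto
  moreover have "i div l < length u" using assms(4) by (simp add: less_mult_imp_div_less mult.commute)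
  ultimately show ?thesis using word_morphism_concat[OF assms(1,3)] by simp
qed

text \<open>With constant length \<open>l\<close>, coordinate \<open>i\<close> lies in the block of
  index \<open>i div l\<close> at offset \<open>i mod l\<close>; floor division makes one formula
  serve both halves of the sequence.\<close>

lemma bi_image_uniform:
  assumes \<sigma>: "word_morphism B A \<sigma>" "\<And>b. b \<in> B \<Longrightarrow> length (\<sigma> [b]) = l" and l: "l > 0"
    and y: "\<And>i. y i \<in> B"
  shows "bi_image \<sigma> y i = \<sigma> [y (i div int l)] ! nat (i mod int l)"
proof (cases "0 \<le> i")
  case True
  define n where "n = nat i"
  have i: "i = int n" using True by (simp add: n_def)
  have mem: "map y [0..i] \<in> lists B" using y by auto
  have lt: "n < l * length (map y [0..i])" using l by (cases l) (auto simp: i)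
  have "bi_image \<sigma> y i = \<sigma> (map y [0..i]) ! n" using True by (simp add: bi_image_def n_def)
  also have "\<dots> = \<sigma> [map y [0..i] ! (n div l)] ! (n mod l)"
    by (rule nth_uniform_morphism[OF \<sigma> mem lt])
  also have "map y [0..i] ! (n div l) = y ([0..i] ! (n div l))" by (intro nth_map) (simp add: i nat_add_distrib less_Suc_eq_le)
  also have "[0..i] ! (n div l) = i div int l" using nth_upto[of 0 "n div l" i] by (simp add: i flip: zdiv_int)
  finally show ?thesis by (simp add: i flip: zmod_int)
next
  case False
  define n where "n = nat (- i)"
  have i: "i = - int n" and n: "n > 0" using False by (auto simp: n_def)
  have mem: "map y [i..-1] \<in> lists B" using y by auto
  have len: "length (\<sigma> (map y [i..-1])) = l * n"
    using length_uniform_morphism[OF \<sigma> mem] by (simp add: i)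
  have nl: "n \<le> l * n" using l by simp
  \<comment> \<open>The image of the letters from \<open>i = - n\<close> to \<open>-1\<close> has
    \<open>l * n\<close> letters and ends at coordinate \<open>-1\<close>, so coordinate
    \<open>- n\<close> has index \<open>l * n - n\<close>. This is \<open>i\<close> plus a multiple
    of \<open>l\<close>, which relates the two divisions.\<close>
  define p where "p = l * n - n"
  have p: "int p = i + int l * int n" using nl by (simp add: p_def i of_nat_diff)
  have lt: "p < l * length (map y [i..-1])" using nl n by (simp add: p_def i)
  have "p div l < n" using lt l by (simp add: i less_mult_imp_div_less mult.commute)
  have pd: "int (p div l) = i div int l + int n" using l by (simp add: zdiv_int p)
  have "bi_image \<sigma> y i = \<sigma> (map y [i..-1]) ! p"
    using False by (simp add: bi_image_def Let_def len p_def n_def)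
  also have "\<dots> = \<sigma> [map y [i..-1] ! (p div l)] ! (p mod l)"
    by (rule nth_uniform_morphism[OF \<sigma> mem lt])
  also have "map y [i..-1] ! (p div l) = y (i div int l)"
    using \<open>p div l < n\<close> pd by (simp add: i)
  also have "p mod l = nat (i mod int l)"
    using p by (metis mod_mult_self2 mult.commute nat_int zmod_int)
  finally show ?thesis .
qed

lemma bi_shift_bi_image:
  assumes \<sigma>: "word_morphism B A \<sigma>" "\<And>b. b \<in> B \<Longrightarrow> length (\<sigma> [b]) = l" and l: "l > 0"
    and y: "\<And>i. y i \<in> B"
  shows "(bi_shift ^^ l) (bi_image \<sigma> y) = bi_image \<sigma> (bi_shift y)"
proof
  fix i
  have "bi_image \<sigma> (bi_shift y) i = \<sigma> [y (i div int l + 1)] ! nat (i mod int l)"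
    using y by (subst bi_image_uniform[OF \<sigma> l]) (auto simp: bi_shift_def)
  moreover have "(bi_shift ^^ l) (bi_image \<sigma> y) i = \<sigma> [y ((i + int l) div int l)] ! nat ((i + int l) mod int l)"
    unfolding bi_shift_funpow using y by (subst bi_image_uniform[OF \<sigma> l]) auto
  ultimately show "(bi_shift ^^ l) (bi_image \<sigma> y) i = bi_image \<sigma> (bi_shift y) i"
    using l by simp
qed

text \<open>Floor division by \<open>l\<close> never moves a coordinate away from zero, so a window
  of the image depends on at most the same window of the preimage.\<close>

lemma agree_bi_image:
  assumes \<sigma>: "word_morphism B A \<sigma>" "\<And>b. b \<in> B \<Longrightarrow> length (\<sigma> [b]) = l" and l: "l > 0"
    and y: "\<And>i. y i \<in> B" and z: "\<And>i. z i \<in> B" and a: "agree n y z"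
  shows "agree n (bi_image \<sigma> y) (bi_image \<sigma> z)"
  unfolding agree_def
proof (intro allI impI)
  fix i :: int assume i: "\<bar>i\<bar> \<le> int n"
  have "\<bar>i div int l\<bar> \<le> \<bar>i\<bar>"
  proof (cases "0 \<le> i")
    case True
    then show ?thesis using l zdiv_mono2[of i 1 "int l"] by (simp add: pos_imp_zdiv_nonneg_iff)
  next
    case False
    then show ?thesis using l zdiv_mono2_neg[of i 1 "int l"] pos_imp_zdiv_neg_iff[of "int l" i] by simp
  qed
  then have "y (i div int l) = z (i div int l)" using a i by (simp add: agree_def)
  then show "bi_image \<sigma> y i = bi_image \<sigma> z i"
    using y z by (simp add: bi_image_uniform[OF \<sigma> l])
qed

section \<open>Occurrences of words in concatenations\<close>

definition occurrences :: "'a list \<Rightarrow> 'a list \<Rightarrow> nat set" where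
  "occurrences w u = {k. k + length w \<le> length u \<and> take (length w) (drop k u) = w}"

lemma finite_occurrences [simp]: "finite (occurrences w u)"
  by (rule finite_subset[of _ "{..length u}"]) (auto simp: occurrences_def)

lemma occurrences_subset:
  assumes "w \<noteq> []" shows "occurrences w u \<subseteq> {..<length u}"
proof
  fix k assume "k \<in> occurrences w u"
  moreover have "length w > 0" using assms by simp
  ultimately show "k \<in> {..<length u}"
    unfolding occurrences_def by (simp only: mem_Collect_eq lessThan_iff) linarith
qed

lemma card_occurrences_le: "w \<noteq> [] \<Longrightarrow> card (occurrences w u) \<le> length u"
  using card_mono[OF _ occurrences_subset] by fastforce

text \<open>An occurrence in \<open>u @ v\<close> that lies in neither factor straddles the seam and
  so starts among the last \<open>length w\<close> positions of \<open>u\<close>.\<close>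

lemma card_occurrences_append:
  assumes w: "w \<noteq> []"
  shows "card (occurrences w u) + card (occurrences w v) \<le> card (occurrences w (u @ v))"
    and "card (occurrences w (u @ v)) \<le> card (occurrences w u) + card (occurrences w v) + length w"
proof -
  let ?V = "(+) (length u) ` occurrences w v" and ?M = "{length u - length w..<length u}"
  have u: "occurrences w u \<subseteq> occurrences w (u @ v)" by (auto simp: occurrences_def)
  have v: "?V \<subseteq> occurrences w (u @ v)" by (auto simp: occurrences_def)
  have cv: "card ?V = card (occurrences w v)" by (rule card_image) (auto simp: inj_on_def)
  have uv: "occurrences w (u @ v) \<subseteq> occurrences w u \<union> ?V \<union> ?M"
  proof
    fix k assume k: "k \<in> occurrences w (u @ v)"
    consider "k + length w \<le> length u" | "length u \<le> k" | "k \<in> ?M" by force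
    then show "k \<in> occurrences w u \<union> ?V \<union> ?M"
    proof cases
      case 1
      then show ?thesis using k by (auto simp: occurrences_def)
    next
      case 2
      then have "k - length u \<in> occurrences w v" using k by (auto simp: occurrences_def)
      then show ?thesis using 2 by (auto simp: image_iff intro!: bexI[of _ "k - length u"])
    qed auto
  qed
  have "card (occurrences w (u @ v)) \<le> card (occurrences w u \<union> ?V \<union> ?M)" by (rule card_mono[OF _ uv]) auto
  also have "\<dots> \<le> card (occurrences w u) + card ?V + card ?M"
    by (meson add_mono card_Un_le order_refl order_trans)
  finally show "card (occurrences w (u @ v)) \<le> card (occurrences w u) + card (occurrences w v) + length w"
    unfolding cv by simp
  show "card (occurrences w u) + card (occurrences w v) \<le> card (occurrences w (u @ v))"
  proof -
    have "occurrences w u \<inter> ?V = {}" using w by (auto simp: occurrences_def)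
    then have "card (occurrences w u) + card ?V = card (occurrences w u \<union> ?V)" by (simp add: card_Un_disjoint)
    also have "\<dots> \<le> card (occurrences w (u @ v))" using u v by (intro card_mono) auto
    finally show ?thesis by (simp add: cv)
  qed
qed

text \<open>Each letter of \<open>u\<close> adds one block, and appending a block creates at most
  \<open>length w\<close> straddling occurrences.\<close>

lemma card_occurrences_morphism:
  assumes \<sigma>: "word_morphism B A \<sigma>" and u: "u \<in> lists B" and w: "w \<noteq> []"
  shows "\<bar>real (card (occurrences w (\<sigma> u))) - (\<Sum>b\<leftarrow>u. real (card (occurrences w (\<sigma> [b]))))\<bar>
    \<le> real (length w) * real (length u)"
  using u
proof (induction u rule: list.induct)
  case Nil
  then show ?case using \<sigma> w by (simp add: word_morphism_def occurrences_def)
next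
  case (Cons b u)
  then have "[b] \<in> lists B" "u \<in> lists B" by auto
  then have "\<sigma> ([b] @ u) = \<sigma> [b] @ \<sigma> u" using \<sigma> unfolding word_morphism_def by blast
  then show ?case using card_occurrences_append[OF w, of "\<sigma> [b]" "\<sigma> u"] Cons by (simp add: algebra_simps)
qed

lemma sum_list_map_eq_sum_count_real:
  fixes f :: "'a \<Rightarrow> real"
  assumes "set u \<subseteq> C" "finite C"
  shows "(\<Sum>c\<leftarrow>u. f c) = (\<Sum>c\<in>C. real (count_list u c) * f c)"
  using assms(1)
proof (induction u)
  case (Cons b u)
  have "(\<Sum>c\<in>C. real (count_list (b # u) c) * f c) = (\<Sum>c\<in>C. (if c = b then f c else 0) + real (count_list u c) * f c)"
    by (intro sum.cong) (auto simp: algebra_simps)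
  also have "\<dots> = f b + (\<Sum>c\<in>C. real (count_list u c) * f c)"
    using Cons.prems assms(2) by (simp add: sum.distrib sum.delta)
  finally show ?case using Cons by simp
qed simp

text \<open>Doeblin's argument: the common part \<open>v\<close> of the letter counts contributes the same amount to
  every word, so only the remaining fraction of the oscillation of \<open>f\<close> survives.\<close>

lemma doeblin_contraction:
  fixes f :: "'a \<Rightarrow> real" and v :: "'a \<Rightarrow> nat"
  assumes C: "finite C" and f: "\<And>c. c \<in> C \<Longrightarrow> lo \<le> f c \<and> f c \<le> lo + D"
    and l: "l > 0"
  shows "\<exists>lo'. \<forall>u. set u \<subseteq> C \<and> length u = l \<and> (\<forall>c\<in>C. v c \<le> count_list u c) \<longrightarrow>
    lo' \<le> (\<Sum>c\<leftarrow>u. f c) / real l \<and>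
    (\<Sum>c\<leftarrow>u. f c) / real l \<le> lo' + (1 - real (\<Sum>c\<in>C. v c) / real l) * D"
proof -
  let ?s = "real l - real (\<Sum>c\<in>C. v c)"
  \<comment> \<open>After the common part \<open>?s\<close> letters remain; giving all of them the
    value \<open>lo\<close> yields the lower bound \<open>?L\<close>, giving them
    \<open>lo + D\<close> adds \<open>?s * D\<close>.\<close>
  let ?L = "(\<Sum>c\<in>C. real (v c) * f c) + ?s * lo"
  have "?L / real l \<le> (\<Sum>c\<leftarrow>u. f c) / real l \<and>
      (\<Sum>c\<leftarrow>u. f c) / real l \<le> ?L / real l + (1 - real (\<Sum>c\<in>C. v c) / real l) * D"
    if u: "set u \<subseteq> C" "length u = l" "\<And>c. c \<in> C \<Longrightarrow> v c \<le> count_list u c" for u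
  proof -
    let ?r = "\<lambda>c. real (count_list u c) - real (v c)"
    have r: "?r c \<ge> 0" if "c \<in> C" for c using u(3)[OF that] by simp
    have sr: "(\<Sum>c\<in>C. ?r c) = ?s"
      using sum_count_set[OF u(1) C] u(2) by (simp add: sum_subtractf flip: of_nat_sum)
    have F: "(\<Sum>c\<leftarrow>u. f c) = (\<Sum>c\<in>C. real (v c) * f c) + (\<Sum>c\<in>C. ?r c * f c)"
      unfolding sum_list_map_eq_sum_count_real[OF u(1) C] sum.distrib[symmetric]
      by (intro sum.cong) (auto simp: algebra_simps)
    have "(\<Sum>c\<in>C. ?r c * lo) \<le> (\<Sum>c\<in>C. ?r c * f c)"
      using r f by (intro sum_mono mult_left_mono) auto
    moreover have "(\<Sum>c\<in>C. ?r c * f c) \<le> (\<Sum>c\<in>C. ?r c * (lo + D))"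
      using r f by (intro sum_mono mult_left_mono) auto
    ultimately have "?L \<le> (\<Sum>c\<leftarrow>u. f c)" "(\<Sum>c\<leftarrow>u. f c) \<le> ?L + ?s * D"
      unfolding F sum_distrib_right[symmetric] sr by (auto simp: algebra_simps)
    moreover have "(1 - real (\<Sum>c\<in>C. v c) / real l) * D = ?s * D / real l" using l by (simp add: field_simps)
    ultimately show ?thesis using l by (simp add: divide_right_mono flip: add_divide_distrib)
  qed
  then show ?thesis by blast
qed

section \<open>Composed morphisms of constant length\<close>

lemma compose_range_id [simp]: "compose_range \<tau> n n = id"
  by (simp add: compose_range_def)

lemma compose_range_append:
  assumes "n \<le> k" "k \<le> N"
  shows "compose_range \<tau> n N = compose_range \<tau> n k \<circ> compose_range \<tau> k N"
proof -
  have *: "foldr (\<lambda>i f. \<tau> i \<circ> f) xs g = foldr (\<lambda>i f. \<tau> i \<circ> f) xs id \<circ> g" for xs g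
    by (induction xs) (auto simp: o_assoc)
  have "[n..<N] = [n..<k] @ [k..<N]" using assms upt_add_eq_append[of n k "N - k"] by simp
  then show ?thesis unfolding compose_range_def using * by simp
qed

lemma compose_range_Suc [simp]: "compose_range \<tau> n (Suc n) = \<tau> n"
  by (simp add: compose_range_def)

locale uniform_directive =
  fixes A :: "nat \<Rightarrow> 'a set" and \<tau> :: "nat \<Rightarrow> 'a list \<Rightarrow> 'a list" and l :: "nat \<Rightarrow> nat"
  assumes fin: "finite (A n)" and nonempty: "A n \<noteq> {}"
    and morph: "word_morphism (A (Suc n)) (A n) (\<tau> n)"
    and len: "b \<in> A (Suc n) \<Longrightarrow> length (\<tau> n [b]) = l n"
    and l_pos: "l n > 0"
begin

definition height :: "nat \<Rightarrow> nat \<Rightarrow> nat" where "height n N = (\<Prod>i=n..<N. l i)"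

lemma height_pos: "height n N > 0"
  unfolding height_def using l_pos by (simp add: prod_pos)

lemma height_append: "n \<le> k \<Longrightarrow> k \<le> N \<Longrightarrow> height n N = height n k * height k N"
  unfolding height_def by (simp add: prod.atLeastLessThan_concat)

lemma compose_morphism: "n \<le> N \<Longrightarrow> word_morphism (A N) (A n) (compose_range \<tau> n N)"
proof (induction N rule: dec_induct)
  case base
  then show ?case by (simp add: word_morphism_def)
next
  case (step N)
  then have "compose_range \<tau> n (Suc N) = compose_range \<tau> n N \<circ> \<tau> N"
    using compose_range_append[of n N "Suc N" \<tau>] by simp
  then show ?case using word_morphism_compose[OF morph step.IH] by (simp only:)
qed

lemma compose_length: "n \<le> N \<Longrightarrow> b \<in> A N \<Longrightarrow> length (compose_range \<tau> n N [b]) = height n N"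
proof (induction N arbitrary: b rule: dec_induct)
  case base
  then show ?case by (simp add: height_def)
next
  case (step N)
  have "\<tau> N [b] \<in> lists (A N)" using word_morphism_in_lists[OF morph] step.prems by auto
  then have "length (compose_range \<tau> n N (\<tau> N [b])) = height n N * length (\<tau> N [b])"
    using step by (intro length_uniform_morphism[OF compose_morphism]) auto
  moreover have "compose_range \<tau> n (Suc N) = compose_range \<tau> n N \<circ> \<tau> N"
    using compose_range_append[of n N "Suc N" \<tau>] step by simp
  ultimately show ?case using step len[of b N] by (simp add: height_def)
qed

lemma compose_in_lists: "n \<le> N \<Longrightarrow> b \<in> A N \<Longrightarrow> set (compose_range \<tau> n N [b]) \<subseteq> A n"
  using word_morphism_in_lists[OF compose_morphism, of n N "[b]"] by auto

end

section \<open>Invariant probabilities are determined by the masses of words\<close>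

lemma level_subshift_eq: "level_subshift A \<tau> n = word_subshift (A n) (level_language A \<tau> n)"
  by (simp add: level_subshift_def word_subshift_def)

lemma invariant_probability_space:
  assumes "invariant_probability (subshift_topology A (word_subshift A L)) bi_shift \<mu>"
  shows "space \<mu> = word_subshift A L"
proof -
  have "sets \<mu> = sets (borel_sigma (subshift_topology A (word_subshift A L)))"
    using assms by (simp add: invariant_probability_def)
  from sets_eq_imp_space_eq[OF this] show ?thesis by (simp add: topspace_subshift_topology[OF word_subshift_subset])
qed

text \<open>Window sets use windows centred at \<open>0\<close>, whereas frequencies count words
  from their starting position; \<open>n\<close> shifts carry one kind of cylinder to the
  other.\<close>

lemma invariant_probability_word_cylinder:
  assumes \<mu>: "invariant_probability (subshift_topology A (word_subshift A L)) bi_shift \<mu>"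
  shows "{x \<in> word_subshift A L. map x [i..j] = w} \<in> sets \<mu>"
    and "measure \<mu> {x \<in> word_subshift A L. map x [-int n..int n] = w} =
      measure \<mu> {x \<in> word_subshift A L. map x [0..2 * int n] = w}"
proof -
  let ?X = "word_subshift A L"
  have meas: "{x \<in> ?X. map x [i..j] = w} \<in> sets \<mu>" for i j
  proof -
    have "{x \<in> ?X. map x [i..j] = w} \<in> window_sets ?X"
    proof (rule window_setsI[of _ _ "nat \<bar>i\<bar> + nat \<bar>j\<bar>"])
      fix x y assume "x \<in> {x \<in> ?X. map x [i..j] = w}" "y \<in> ?X" "agree (nat \<bar>i\<bar> + nat \<bar>j\<bar>) x y"
      moreover from this have "map x [i..j] = map y [i..j]" by (intro agree_map_eq) auto
      ultimately show "y \<in> {x \<in> ?X. map x [i..j] = w}" by (simp del: map_eq_conv)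
    qed auto
    then show ?thesis
      using \<mu> sets_borel_subshift[OF word_subshift_subset, of A L] by (auto simp: invariant_probability_def)
  qed
  then show "{x \<in> ?X. map x [i..j] = w} \<in> sets \<mu>" .
  have "map ((bi_shift ^^ n) x) [-int n..int n] = map x [0..2 * int n]" for x :: "int \<Rightarrow> 'a"
    by (rule nth_equalityI) (auto simp: bi_shift_funpow)
  then have "(bi_shift ^^ n) -` {x \<in> ?X. map x [-int n..int n] = w} \<inter> space \<mu> = {x \<in> ?X. map x [0..2 * int n] = w}"
    using bi_shift_word_subshift[of _ A L n] by (auto simp: invariant_probability_space[OF \<mu>])
  then show "measure \<mu> {x \<in> ?X. map x [-int n..int n] = w} = measure \<mu> {x \<in> ?X. map x [0..2 * int n] = w}"
    using invariant_probability_funpow(1)[OF \<mu> meas[of "-int n" "int n"], of n] by (simp add: measure_def)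
qed

text \<open>Over a finite alphabet every window set is a finite disjoint union of cylinders over one
  centred window, and invariance moves these to cylinders starting at \<open>0\<close>.\<close>

lemma invariant_probability_eqI:
  assumes A: "finite A"
    and \<mu>: "invariant_probability (subshift_topology A (word_subshift A L)) bi_shift \<mu>"
    and \<nu>: "invariant_probability (subshift_topology A (word_subshift A L)) bi_shift \<nu>"
    and eq: "\<And>w. w \<noteq> [] \<Longrightarrow> measure \<mu> {x \<in> word_subshift A L. map x [0..int (length w) - 1] = w} =
      measure \<nu> {x \<in> word_subshift A L. map x [0..int (length w) - 1] = w}"
  shows "\<mu> = \<nu>"
proof (rule measure_eq_on_window_sets[OF word_subshift_subset])
  let ?X = "word_subshift A L"
  interpret \<mu>: prob_space \<mu> using \<mu> by (simp add: invariant_probability_def)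
  interpret \<nu>: prob_space \<nu> using \<nu> by (simp add: invariant_probability_def)
  fix B assume "B \<in> window_sets ?X"
  then obtain n where n: "\<And>x y m. x \<in> B \<Longrightarrow> y \<in> ?X \<Longrightarrow> n \<le> m \<Longrightarrow> agree m x y \<Longrightarrow> y \<in> B" "B \<subseteq> ?X"
    by (elim window_setsE) blast
  let ?win = "\<lambda>x::int \<Rightarrow> 'a. map x [-int n..int n]"
  let ?C = "\<lambda>w. {x \<in> ?X. ?win x = w}"
  define V where "V = ?win ` B"
  have "V \<subseteq> {w. set w \<subseteq> A \<and> length w = 2 * n + 1}"
    using n(2) word_subshift_subset by (fastforce simp: V_def)
  then have V: "finite V" using finite_lists_length_eq[OF A] by (rule finite_subset)
  have B: "B = (\<Union>w\<in>V. ?C w)"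
  proof
    show "(\<Union>w\<in>V. ?C w) \<subseteq> B"
    proof
      fix y assume "y \<in> (\<Union>w\<in>V. ?C w)"
      then obtain x where x: "x \<in> B" "y \<in> ?X" "?win y = ?win x" by (auto simp: V_def)
      have "agree n x y" unfolding agree_def
      proof (intro allI impI)
        fix i :: int assume "\<bar>i\<bar> \<le> int n"
        then have "i \<in> set [-int n..int n]" by auto
        then show "x i = y i" using x(3) by (metis map_eq_conv)
      qed
      then show "y \<in> B" using n(1)[of x y n] x by blast
    qed
  qed (use n(2) in \<open>auto simp: V_def\<close>)
  have dis: "disjoint_family_on ?C V" by (auto simp: disjoint_family_on_def)
  have "measure \<mu> (?C w) = measure \<nu> (?C w)" if "w \<in> V" for w
  proof -
    have "length w = 2 * n + 1" using that by (auto simp: V_def)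
    then have "int (length w) - 1 = 2 * int n" "w \<noteq> []" by auto
    then show ?thesis using eq[of w] invariant_probability_word_cylinder(2)[OF \<mu>]
      invariant_probability_word_cylinder(2)[OF \<nu>] by simp
  qed
  moreover have "measure \<mu> B = (\<Sum>w\<in>V. measure \<mu> (?C w))"
    unfolding B using V dis invariant_probability_word_cylinder(1)[OF \<mu>]
    by (intro \<mu>.finite_measure_finite_Union) auto
  moreover have "measure \<nu> B = (\<Sum>w\<in>V. measure \<nu> (?C w))"
    unfolding B using V dis invariant_probability_word_cylinder(1)[OF \<nu>]
    by (intro \<nu>.finite_measure_finite_Union) auto
  ultimately show "emeasure \<mu> B = emeasure \<nu> B"
    by (simp add: \<mu>.emeasure_eq_measure \<nu>.emeasure_eq_measure)
qed (use \<mu> \<nu> in \<open>auto simp: invariant_probability_def\<close>)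

lemma sum_list_map_concat:
  fixes f :: "'a \<Rightarrow> real"
  shows "(\<Sum>c\<leftarrow>concat ws. f c) = (\<Sum>w\<leftarrow>ws. \<Sum>c\<leftarrow>w. f c)"
  by (induction ws) auto

lemma prod_one_minus_small:
  fixes \<alpha> :: "nat \<Rightarrow> real"
  assumes \<alpha>: "\<And>i. 0 \<le> \<alpha> i \<and> \<alpha> i \<le> 1" and div: "\<not> summable \<alpha>" and e: "e > 0"
  obtains k where "k \<ge> K" "(\<Prod>i=j..<k. 1 - \<alpha> i) < e"
proof -
  \<comment> \<open>With this \<open>m\<close>, the sum from \<open>j\<close> up to any end beyond
    \<open>m\<close> and \<open>j\<close> exceeds \<open>- ln e\<close>; the product is then small
    because \<open>1 - x \<le> exp (- x)\<close>.\<close>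
  obtain m where m: "(\<Sum>i<m. \<alpha> i) > (\<Sum>i<j. \<alpha> i) - ln e"
    using summableI_nonneg_bounded[of \<alpha>] \<alpha> div by (meson not_le)
  define k where "k = max (max K j) m"
  have "(\<Sum>i<m. \<alpha> i) \<le> (\<Sum>i<k. \<alpha> i)" using \<alpha> by (intro sum_mono2) (auto simp: k_def)
  also have "\<dots> = (\<Sum>i<j. \<alpha> i) + (\<Sum>i=j..<k. \<alpha> i)"
    by (simp add: k_def lessThan_atLeast0 sum.atLeastLessThan_concat)
  finally have s: "- (\<Sum>i=j..<k. \<alpha> i) < ln e" using m by linarith
  have "1 - \<alpha> i \<le> exp (- \<alpha> i)" for i
    using exp_ge_add_one_self[of "- \<alpha> i"] by simp
  then have "(\<Prod>i=j..<k. 1 - \<alpha> i) \<le> (\<Prod>i=j..<k. exp (- \<alpha> i))"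
    using \<alpha> by (intro prod_mono) auto
  also have "\<dots> = exp (- (\<Sum>i=j..<k. \<alpha> i))" by (simp add: exp_sum[symmetric] sum_negf)
  also have "\<dots> < exp (ln e)" using s by (simp only: exp_less_cancel_iff)
  also have "\<dots> = e" using e by simp
  finally show ?thesis using that[of k] by (simp add: k_def)
qed

section \<open>Directive sequences of growing height\<close>

text \<open>Nonemptiness of the subshift enters the argument as \<open>unbounded\<close>: words of
  every length must be factors of words generated by one letter.\<close>

locale growing_directive = uniform_directive +
  assumes unbounded: "\<exists>N. M \<le> height 0 N"
begin

lemma height_mono: "N \<le> N' \<Longrightarrow> height n N \<le> height n N'"
proof (rule dvd_imp_le[OF _ height_pos])
  assume "N \<le> N'"
  then show "height n N dvd height n N'" unfolding height_def by (intro prod_dvd_prod_subset) auto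
qed

lemma height_at_top: "filterlim (height n) at_top sequentially"
  unfolding filterlim_at_top eventually_sequentially
proof
  fix Z
  \<comment> \<open>The factor \<open>height 0 n\<close> compensates for starting at level
    \<open>n\<close> instead of level \<open>0\<close>.\<close>
  obtain N0 where N0: "Z * height 0 n \<le> height 0 N0" using unbounded by blast
  have "Z \<le> height n N" if "N \<ge> max N0 n" for N
  proof -
    have "Z * height 0 n \<le> height 0 N" using N0 height_mono[of N0 N 0] that by simp
    also have "\<dots> = height 0 n * height n N" using that by (intro height_append) auto
    finally show ?thesis using height_pos[of 0 n] by simp
  qed
  then show "\<exists>N. \<forall>M\<ge>N. Z \<le> height n M" by blast
qed

abbreviation X :: "nat \<Rightarrow> (int \<Rightarrow> 'a) set" where "X \<equiv> level_subshift A \<tau>"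
abbreviation T :: "nat \<Rightarrow> (int \<Rightarrow> 'a) topology" where "T n \<equiv> subshift_topology (A n) (X n)"

lemma X_letter: "y \<in> X n \<Longrightarrow> y i \<in> A n"
  by (simp add: level_subshift_def)

text \<open>The bound \<open>j \<le> Ns j\<close> forces the word lengths to infinity, and
  \<open>n < Ns j\<close> puts all factors of these words into the language of level
  \<open>n\<close>.\<close>

lemma level_measure:
  assumes Ns: "\<And>j. n < Ns j" "\<And>j. j \<le> Ns j" and b: "\<And>j. b j \<in> A (Ns j)"
  shows "\<exists>G \<nu>. G \<noteq> bot \<and> invariant_probability (T n) bi_shift \<nu> \<and>
    (\<forall>a. ((\<lambda>j. real (count_list (compose_range \<tau> n (Ns j) [b j]) a) / real (height n (Ns j))) \<longlongrightarrow>
          measure \<nu> (letter_cylinder A \<tau> n a)) G)"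
proof -
  define W where "W j = compose_range \<tau> n (Ns j) [b j]" for j
  have len: "length (W j) = height n (Ns j)" for j
    unfolding W_def using Ns(1)[of j] b by (intro compose_length) auto
  have "filterlim (\<lambda>j. height n (Ns j)) at_top sequentially"
    by (rule filterlim_compose[OF height_at_top])
       (rule filterlim_at_top_mono[OF filterlim_ident], use Ns(2) in auto)
  then have "filterlim (\<lambda>j. length (W j)) at_top sequentially" by (simp add: len)
  moreover have "set (W j) \<subseteq> A n" for j
    unfolding W_def using Ns(1)[of j] b by (intro compose_in_lists) auto
  moreover have "w \<in> level_language A \<tau> n" if "sublist w (W j)" for j w
    using that Ns(1) b unfolding level_language_def W_def by blast
  ultimately obtain G \<nu> where "G \<noteq> bot" "G \<le> sequentially"
    "invariant_probability (subshift_topology (A n) (word_subshift (A n) (level_language A \<tau> n))) bi_shift \<nu>"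
    "\<And>a. ((\<lambda>N. real (count_list (W N) a) / real (length (W N))) \<longlongrightarrow>
          measure \<nu> {x \<in> word_subshift (A n) (level_language A \<tau> n). x 0 = a}) G"
    using empirical_limit[of "A n" W "level_language A \<tau> n"] fin by blast
  then show ?thesis
    unfolding W_def[symmetric] letter_cylinder_def level_subshift_eq len[symmetric] by blast
qed

text \<open>The bottom of the Kakutani-Rokhlin tower over \<open>a\<close>; its shifts by
  \<open>k < height 0 n\<close> are the levels of the tower.\<close>

definition tower_base :: "nat \<Rightarrow> 'a \<Rightarrow> (int \<Rightarrow> 'a) set" where
  "tower_base n a = bi_image (compose_range \<tau> 0 n) ` letter_cylinder A \<tau> n a"

text \<open>The variation of the frequencies of \<open>w\<close> in the words \<open>\<tau>\<^bsub>[0,N)\<^esub>(b)\<close> comes from that of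
  \<open>\<tau>\<^bsub>[0,q)\<^esub>(c)\<close>, contracted by Doeblin's argument, and from the occurrences of \<open>w\<close> that
  straddle two blocks of length \<open>height 0 q\<close>.\<close>

lemma frequency_oscillation:
  assumes ns: "strict_mono ns"
    and v: "\<And>k b a. b \<in> A (ns (Suc k)) \<Longrightarrow> a \<in> A (ns k) \<Longrightarrow>
      v k a \<le> count_list (compose_range \<tau> (ns k) (ns (Suc k)) [b]) a"
    and div: "\<not> summable (\<lambda>k. real (\<Sum>a\<in>A (ns k). v k a) / real (height (ns k) (ns (Suc k))))"
    and w: "w \<noteq> []" and \<delta>: "\<delta> > 0"
  obtains N c where "N \<ge> M" "\<And>a. a \<in> A N \<Longrightarrow>
    \<bar>real (card (occurrences w (compose_range \<tau> 0 N [a]))) / real (height 0 N) - c\<bar> \<le> \<delta>"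
proof -
  let ?m = "length w"
  define \<alpha> where "\<alpha> k = real (\<Sum>a\<in>A (ns k). v k a) / real (height (ns k) (ns (Suc k)))" for k
  have nsS: "ns k \<le> ns (Suc k)" for k using strict_monoD[OF ns, of k "Suc k"] by simp
  have nsm: "ns j \<le> ns k" if "j \<le> k" for j k using that ns by (simp add: strict_mono_less_eq)
  have \<alpha>: "0 \<le> \<alpha> k \<and> \<alpha> k \<le> 1" for k
  proof -
    obtain b where b: "b \<in> A (ns (Suc k))" using nonempty by blast
    have "(\<Sum>a\<in>A (ns k). v k a) \<le> (\<Sum>a\<in>A (ns k). count_list (compose_range \<tau> (ns k) (ns (Suc k)) [b]) a)"
      using v b by (intro sum_mono) auto
    also have "\<dots> = height (ns k) (ns (Suc k))"
      using sum_count_set[OF compose_in_lists[OF nsS b] fin] compose_length[OF nsS b] by simp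
    finally have "real (\<Sum>a\<in>A (ns k). v k a) \<le> real (height (ns k) (ns (Suc k)))" by (simp only: of_nat_le_iff)
    then show ?thesis using height_pos[of "ns k" "ns (Suc k)"] by (simp add: \<alpha>_def divide_le_eq del: of_nat_sum)
  qed
  have div': "\<not> summable \<alpha>" using div unfolding \<alpha>_def .
  \<comment> \<open>Blocks of this height make straddling occurrences contribute at most
    \<open>\<delta> / 2\<close>; the other half is left for the oscillation.\<close>
  obtain q0 where q0: "nat \<lceil>2 * real ?m / \<delta>\<rceil> \<le> height 0 q0" using unbounded by blast
  define j where "j = max q0 M"
  define q where "q = ns j"
  have jq: "j \<le> q" unfolding q_def using ns by (rule strict_mono_imp_increasing)
  have "nat \<lceil>2 * real ?m / \<delta>\<rceil> \<le> height 0 q" using q0 height_mono[of q0 q 0] jq by (simp add: j_def)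
  then have "2 * real ?m / \<delta> \<le> real (height 0 q)" by linarith
  then have hq: "real ?m / real (height 0 q) \<le> \<delta> / 2"
    using \<delta> height_pos[of 0 q] by (simp add: field_simps)
  define f where "f c = real (card (occurrences w (compose_range \<tau> 0 q [c]))) / real (height 0 q)" for c
  have f: "0 \<le> f c \<and> f c \<le> 1" if "c \<in> A q" for c
    using card_occurrences_le[OF w, of "compose_range \<tau> 0 q [c]"] compose_length[of 0 q c] that
    by (simp add: f_def divide_le_eq)
  \<comment> \<open>The frequency of \<open>w\<close> in the word of level \<open>ns k\<close> when
    occurrences straddling two blocks of level \<open>q\<close> are ignored.\<close>
  define g where "g k b = (\<Sum>c\<leftarrow>compose_range \<tau> q (ns k) [b]. f c) / real (height q (ns k))" for k b
  \<comment> \<open>At \<open>k = j\<close> the frequencies lie in the unit interval, matching the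
    empty product \<open>1\<close>; each further step multiplies the oscillation by the Doeblin
    factor \<open>1 - \<alpha> k\<close>.\<close>
  have osc: "\<exists>lo. \<forall>b\<in>A (ns k). lo \<le> g k b \<and> g k b \<le> lo + (\<Prod>i=j..<k. 1 - \<alpha> i)" if "j \<le> k" for k
    using that
  proof (induction k rule: dec_induct)
    case base
    then show ?case using f by (intro exI[of _ 0]) (auto simp: g_def q_def height_def)
  next
    case (step k)
    then obtain lo where lo: "\<And>b. b \<in> A (ns k) \<Longrightarrow> lo \<le> g k b \<and> g k b \<le> lo + (\<Prod>i=j..<k. 1 - \<alpha> i)"
      by blast
    let ?h = "height (ns k) (ns (Suc k))"
    obtain lo' where lo': "\<forall>u. set u \<subseteq> A (ns k) \<and> length u = ?h \<and> (\<forall>c\<in>A (ns k). v k c \<le> count_list u c) \<longrightarrow>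
        lo' \<le> (\<Sum>c\<leftarrow>u. g k c) / real ?h \<and>
        (\<Sum>c\<leftarrow>u. g k c) / real ?h \<le> lo' + (1 - real (\<Sum>c\<in>A (ns k). v k c) / real ?h) * (\<Prod>i=j..<k. 1 - \<alpha> i)"
      using doeblin_contraction[where C = "A (ns k)" and f = "g k" and v = "v k", OF fin lo height_pos] by blast
    \<comment> \<open>Grouping the letters of level \<open>q\<close> by the letter of level
      \<open>ns k\<close> that they come from gives groups of equal size, so the next average is an
      average of the present ones.\<close>
    have gS: "g (Suc k) b = (\<Sum>c\<leftarrow>compose_range \<tau> (ns k) (ns (Suc k)) [b]. g k c) / real ?h"
      if b: "b \<in> A (ns (Suc k))" for b
    proof -
      let ?u = "compose_range \<tau> (ns k) (ns (Suc k)) [b]"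
      have qk: "q \<le> ns k" unfolding q_def using step by (intro nsm) auto
      have u: "?u \<in> lists (A (ns k))" using compose_in_lists[OF nsS b] by auto
      have "compose_range \<tau> q (ns (Suc k)) [b] = compose_range \<tau> q (ns k) ?u"
        using compose_range_append[OF qk nsS, of \<tau>] by simp
      also have "\<dots> = concat (map (\<lambda>d. compose_range \<tau> q (ns k) [d]) ?u)"
        by (rule word_morphism_concat[OF compose_morphism[OF qk] u])
      finally have "(\<Sum>c\<leftarrow>compose_range \<tau> q (ns (Suc k)) [b]. f c) =
          (\<Sum>d\<leftarrow>?u. \<Sum>c\<leftarrow>compose_range \<tau> q (ns k) [d]. f c)"
        by (simp add: sum_list_map_concat o_def)
      also have "\<dots> = (\<Sum>d\<leftarrow>?u. real (height q (ns k)) * g k d)"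
        using height_pos[of q "ns k"] by (simp add: g_def)
      also have "\<dots> = real (height q (ns k)) * (\<Sum>d\<leftarrow>?u. g k d)" by (rule sum_list_const_mult)
      finally show ?thesis
        using height_append[OF qk nsS] height_pos[of q "ns k"] by (simp add: g_def[of "Suc k"])
    qed
    have "\<forall>b\<in>A (ns (Suc k)). lo' \<le> g (Suc k) b \<and> g (Suc k) b \<le> lo' + (\<Prod>i=j..<Suc k. 1 - \<alpha> i)"
    proof
      fix b assume b: "b \<in> A (ns (Suc k))"
      show "lo' \<le> g (Suc k) b \<and> g (Suc k) b \<le> lo' + (\<Prod>i=j..<Suc k. 1 - \<alpha> i)"
        using lo'[rule_format, of "compose_range \<tau> (ns k) (ns (Suc k)) [b]"]
          compose_in_lists[OF nsS b] compose_length[OF nsS b] v[OF b] gS[OF b] step(1)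
        by (simp add: \<alpha>_def mult.commute)
    qed
    then show ?case by blast
  qed
  obtain k where k: "k \<ge> j" "(\<Prod>i=j..<k. 1 - \<alpha> i) < \<delta> / 2"
    using \<delta> by (auto intro: prod_one_minus_small[OF \<alpha> div', of "\<delta> / 2" j j])
  obtain lo where lo: "\<And>b. b \<in> A (ns k) \<Longrightarrow> lo \<le> g k b \<and> g k b \<le> lo + (\<Prod>i=j..<k. 1 - \<alpha> i)"
    using osc[OF k(1)] by blast
  have "\<bar>real (card (occurrences w (compose_range \<tau> 0 (ns k) [a]))) / real (height 0 (ns k)) - lo\<bar> \<le> \<delta>"
    if a: "a \<in> A (ns k)" for a
  proof -
    let ?u = "compose_range \<tau> q (ns k) [a]"
    have qk: "q \<le> ns k" unfolding q_def using k by (intro nsm) auto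
    have u: "?u \<in> lists (A q)" using compose_in_lists[OF qk a] by auto
    have comp: "compose_range \<tau> 0 (ns k) [a] = compose_range \<tau> 0 q ?u"
      using compose_range_append[OF le0 qk, of \<tau>] by simp
    have H: "height 0 (ns k) = height 0 q * height q (ns k)" by (rule height_append[OF le0 qk])
    let ?o = "real (card (occurrences w (compose_range \<tau> 0 (ns k) [a])))"
    have "\<bar>?o - (\<Sum>c\<leftarrow>?u. real (card (occurrences w (compose_range \<tau> 0 q [c]))))\<bar> \<le> real ?m * real (length ?u)"
      unfolding comp by (rule card_occurrences_morphism[OF compose_morphism[OF le0] u w])
    also have "(\<Sum>c\<leftarrow>?u. real (card (occurrences w (compose_range \<tau> 0 q [c])))) = (\<Sum>c\<leftarrow>?u. real (height 0 q) * f c)"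
      using height_pos[of 0 q] by (simp add: f_def)
    also have "\<dots> = real (height 0 q) * (\<Sum>c\<leftarrow>?u. f c)" by (rule sum_list_const_mult)
    also have "\<dots> = real (height 0 (ns k)) * g k a" using height_pos[of q "ns k"] by (simp add: H g_def)
    also have "length ?u = height q (ns k)" using compose_length[OF qk a] .
    finally have "\<bar>?o - real (height 0 (ns k)) * g k a\<bar> / real (height 0 (ns k)) \<le>
        real ?m * real (height q (ns k)) / real (height 0 (ns k))" by (rule divide_right_mono) simp
    also have "\<dots> = real ?m / real (height 0 q)" using height_pos[of q "ns k"] by (simp add: H)
    also have "\<bar>?o - real (height 0 (ns k)) * g k a\<bar> / real (height 0 (ns k)) = \<bar>?o / real (height 0 (ns k)) - g k a\<bar>"
    proof -
      have "?o / real (height 0 (ns k)) - g k a = (?o - real (height 0 (ns k)) * g k a) / real (height 0 (ns k))"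
        using height_pos[of 0 "ns k"] by (simp add: diff_divide_distrib)
      then show ?thesis by simp
    qed
    finally show ?thesis using hq k(2) lo[OF a] by linarith
  qed
  moreover have "ns k \<ge> M" using k(1) strict_mono_imp_increasing[OF ns, of k] by (simp add: j_def)
  ultimately show ?thesis using that by blast
qed

end

section \<open>Towers of a recognizable sequence\<close>

locale recognizable_directive = growing_directive +
  assumes recog: "recognizable A \<tau>"
begin

abbreviation \<sigma> :: "nat \<Rightarrow> 'a list \<Rightarrow> 'a list" where "\<sigma> n \<equiv> compose_range \<tau> 0 n"

lemma level_partition:
  shows "disjoint_family_on (\<lambda>(a, k). (bi_shift ^^ k) ` tower_base n a) (A n \<times> {..<height 0 n})"
    and "(\<Union>(a, k)\<in>A n \<times> {..<height 0 n}. (bi_shift ^^ k) ` tower_base n a) = X 0"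
proof -
  have I: "(SIGMA a : A n. {..<length (\<sigma> n [a])}) = A n \<times> {..<height 0 n}"
    using compose_length[of 0 n] by (intro Sigma_cong) auto
  have "disjoint_family_on (\<lambda>(a, k). (bi_shift ^^ k) ` tower_base n a) (SIGMA a : A n. {..<length (\<sigma> n [a])}) \<and>
      (\<Union>(a, k)\<in>(SIGMA a : A n. {..<length (\<sigma> n [a])}). (bi_shift ^^ k) ` tower_base n a) = X 0"
    using recog unfolding recognizable_def Let_def tower_base_def by blast
  then show "disjoint_family_on (\<lambda>(a, k). (bi_shift ^^ k) ` tower_base n a) (A n \<times> {..<height 0 n})"
    "(\<Union>(a, k)\<in>A n \<times> {..<height 0 n}. (bi_shift ^^ k) ` tower_base n a) = X 0"
    unfolding I by (rule conjunct1, rule conjunct2)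
qed

lemma level_partition_unique:
  assumes "a \<in> A n" "b \<in> A n" "j < height 0 n" "k < height 0 n"
    and "x \<in> (bi_shift ^^ j) ` tower_base n a" "x \<in> (bi_shift ^^ k) ` tower_base n b"
  shows "a = b \<and> j = k"
proof (rule ccontr)
  assume "\<not> (a = b \<and> j = k)"
  then have "(a, j) \<noteq> (b, k)" by simp
  then have "(bi_shift ^^ j) ` tower_base n a \<inter> (bi_shift ^^ k) ` tower_base n b = {}"
    using disjoint_family_onD[OF level_partition(1), of "(a, j)" n "(b, k)"] assms(1-4) by simp
  then show False using assms(5,6) by blast
qed

lemma tower_base_subset:
  assumes "a \<in> A n" shows "tower_base n a \<subseteq> X 0"
proof
  fix x assume "x \<in> tower_base n a"
  then have "x \<in> (\<Union>(a, k)\<in>A n \<times> {..<height 0 n}. (bi_shift ^^ k) ` tower_base n a)"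
    using assms height_pos[of 0 n] by (intro UN_I[of "(a, 0)"]) auto
  then show "x \<in> X 0" by (simp only: level_partition(2))
qed

lemma bi_shift_X: "x \<in> X n \<Longrightarrow> (bi_shift ^^ k) x \<in> X n"
  using bi_shift_word_subshift unfolding level_subshift_eq .

lemma X_subset: "X n \<subseteq> {x. \<forall>i. x i \<in> A n}"
  by (auto simp: level_subshift_def)

text \<open>Recognizability gives this directly: the image lies in the base of one of the towers
  whose levels make up \<open>X 0\<close>.\<close>

lemma bi_image_X: "y \<in> X n \<Longrightarrow> bi_image (\<sigma> n) y \<in> X 0"
  using tower_base_subset[of "y 0" n] X_letter[of y n 0]
  by (auto simp: tower_base_def letter_cylinder_def)

lemmas level_morphism = compose_morphism[OF le0] compose_length[OF le0] height_pos

lemma continuous_level_image: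
  "continuous_map (T n) (T 0) (\<lambda>y. (bi_shift ^^ k) (bi_image (\<sigma> n) y))"
proof -
  have "continuous_map (T n) (T 0) (bi_image (\<sigma> n))"
  proof (rule continuous_map_subshift[OF X_subset X_subset])
    fix m
    have "agree m (bi_image (\<sigma> n) y) (bi_image (\<sigma> n) z)" if "y \<in> X n" "z \<in> X n" "agree m y z" for y z
      using that X_letter by (intro agree_bi_image[OF level_morphism]) auto
    then show "\<exists>k. \<forall>y\<in>X n. \<forall>z\<in>X n. agree k y z \<longrightarrow> agree m (bi_image (\<sigma> n) y) (bi_image (\<sigma> n) z)"
      by blast
  qed (rule bi_image_X)
  moreover have "continuous_map (T 0) (T 0) (bi_shift ^^ k)"
    using continuous_bi_shift unfolding level_subshift_eq .
  ultimately show ?thesis using continuous_map_compose by (fastforce simp: o_def)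
qed

text \<open>A level is the continuous image of a compact cylinder in a Hausdorff space. Closedness
  is what makes the towers measurable.\<close>

lemma tower_level_closed: "closedin (T 0) ((bi_shift ^^ k) ` tower_base n a)"
proof -
  have "letter_cylinder A \<tau> n a \<in> window_sets (X n)"
    unfolding letter_cylinder_def by (rule window_setsI[of _ _ 0]) (auto simp: agree_def)
  then have "closedin (T n) (letter_cylinder A \<tau> n a)" by (rule window_set_closed[OF X_subset])
  moreover have "compact_space (T n)"
    using compact_subshift_topology[OF fin] by (simp add: level_subshift_eq)
  ultimately have "compactin (T n) (letter_cylinder A \<tau> n a)" by (rule closedin_compact_space[rotated])
  then have "compactin (T 0) ((\<lambda>y. (bi_shift ^^ k) (bi_image (\<sigma> n) y)) ` letter_cylinder A \<tau> n a)"
    using continuous_level_image by (rule image_compactin)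
  then show ?thesis
    by (simp add: tower_base_def image_image compactin_imp_closedin[OF Hausdorff_subshift_topology])
qed

section \<open>Masses of the towers\<close>

lemma invariant_probability_facts:
  assumes "invariant_probability (T n) bi_shift \<mu>"
  shows "prob_space \<mu>" "sets \<mu> = sets (borel_sigma (T n))" "space \<mu> = X n"
  using assms invariant_probability_space[of "A n" "level_language A \<tau> n" \<mu>]
  by (auto simp: invariant_probability_def level_subshift_eq)

lemma tower_level_measurable:
  "invariant_probability (T 0) bi_shift \<mu> \<Longrightarrow> (bi_shift ^^ k) ` tower_base n a \<in> sets \<mu>"
  using closedin_in_borel_sigma[OF tower_level_closed] by (simp add: invariant_probability_facts(2))

text \<open>The shift is injective, so pulling the \<open>k\<close>-th level back by
  \<open>k\<close> shifts returns the base without additional points.\<close>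

lemma measure_tower_level:
  assumes \<mu>: "invariant_probability (T 0) bi_shift \<mu>" and a: "a \<in> A n"
  shows "measure \<mu> ((bi_shift ^^ k) ` tower_base n a) = measure \<mu> (tower_base n a)"
proof -
  have inj: "x = y" if "(bi_shift ^^ k) x = (bi_shift ^^ k) y" for x y :: "int \<Rightarrow> 'a"
  proof
    fix i show "x i = y i" using fun_cong[OF that, of "i - int k"] by (simp add: bi_shift_funpow)
  qed
  have "(bi_shift ^^ k) -` ((bi_shift ^^ k) ` tower_base n a) \<inter> space \<mu> = tower_base n a"
    using tower_base_subset[OF a] inj invariant_probability_facts(3)[OF \<mu>] by blast
  then show ?thesis
    using invariant_probability_funpow(1)[OF \<mu>[unfolded level_subshift_eq] tower_level_measurable[OF \<mu>], of k k n a]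
    by (simp add: measure_def)
qed

lemma measure_partition:
  assumes \<mu>: "invariant_probability (T 0) bi_shift \<mu>" and B: "B \<in> sets \<mu>"
  shows "measure \<mu> B = (\<Sum>a\<in>A n. \<Sum>k<height 0 n. measure \<mu> (B \<inter> (bi_shift ^^ k) ` tower_base n a))"
proof -
  interpret prob_space \<mu> using invariant_probability_facts[OF \<mu>] by blast
  let ?P = "\<lambda>p. B \<inter> (bi_shift ^^ snd p) ` tower_base n (fst p)"
  let ?I = "A n \<times> {..<height 0 n}"
  have "B \<subseteq> X 0" using sets.sets_into_space[OF B] invariant_probability_facts(3)[OF \<mu>] by simp
  then have "B = (\<Union>p\<in>?I. ?P p)" using level_partition(2)[of n] by (fastforce simp: case_prod_beta)
  moreover have "disjoint_family_on ?P ?I"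
    using level_partition(1)[of n] unfolding disjoint_family_on_def case_prod_beta by blast
  moreover have "?P ` ?I \<subseteq> sets \<mu>" using B tower_level_measurable[OF \<mu>] by auto
  ultimately have "measure \<mu> B = (\<Sum>p\<in>?I. measure \<mu> (?P p))"
    using fin finite_measure_finite_Union[of ?I ?P] by simp
  then show ?thesis by (simp add: sum.cartesian_product case_prod_beta)
qed

text \<open>The levels of one tower have equal mass, so each summand is the mass of a whole tower.
  These are the weights of the convex combinations below.\<close>

lemma sum_tower_base:
  assumes \<mu>: "invariant_probability (T 0) bi_shift \<mu>"
  shows "(\<Sum>a\<in>A n. real (height 0 n) * measure \<mu> (tower_base n a)) = 1"
proof -
  interpret prob_space \<mu> using invariant_probability_facts[OF \<mu>] by blast
  have "measure \<mu> (space \<mu> \<inter> (bi_shift ^^ k) ` tower_base n a) = measure \<mu> (tower_base n a)" if "a \<in> A n" for a k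
    using measure_tower_level[OF \<mu> that] sets.sets_into_space[OF tower_level_measurable[OF \<mu>]]
    by (metis inf.absorb2)
  then show ?thesis using measure_partition[OF \<mu> sets.top, of n] prob_space by simp
qed

text \<open>A point on level \<open>k\<close> starts at offset \<open>k\<close> of the block
  \<open>\<sigma> n [a]\<close>; the bound keeps the window inside that block, where the next letter
  at level \<open>n\<close> does not matter.\<close>

lemma tower_level_letter:
  assumes x: "x \<in> (bi_shift ^^ k) ` tower_base n a" and k: "k + m \<le> height 0 n"
  shows "map x [0..int m - 1] = take m (drop k (\<sigma> n [a]))"
proof -
  obtain y where y: "y \<in> X n" "y 0 = a" "x = (bi_shift ^^ k) (bi_image (\<sigma> n) y)"
    using x by (auto simp: tower_base_def letter_cylinder_def)
  have len: "length (\<sigma> n [a]) = height 0 n" using compose_length[OF le0] X_letter[OF y(1)] y(2) by metis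
  show ?thesis
  proof (rule nth_equalityI)
    fix i assume "i < length (map x [0..int m - 1])"
    then have i: "i < m" by simp
    have "bi_image (\<sigma> n) y (int i + int k) = \<sigma> n [y ((int i + int k) div int (height 0 n))] ! nat ((int i + int k) mod int (height 0 n))"
      by (rule bi_image_uniform) (use level_morphism X_letter[OF y(1)] in auto)
    also have "\<dots> = \<sigma> n [a] ! (k + i)" using i k y(2) by (simp add: nat_add_distrib add.commute flip: of_nat_add)
    finally show "map x [0..int m - 1] ! i = take m (drop k (\<sigma> n [a])) ! i"
      using i k by (simp add: y(3) bi_shift_funpow len)
  qed (use k len in simp)
qed

text \<open>Below the top \<open>length w\<close> levels of the tower over \<open>a\<close>, the
  cylinder of \<open>w\<close> contains a level entirely or misses it, according to the occurrences
  in \<open>\<sigma> n [a]\<close>. The undecided levels of all towers together have mass at most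
  \<open>length w / height 0 n\<close>.\<close>

lemma measure_word_estimate:
  assumes \<mu>: "invariant_probability (T 0) bi_shift \<mu>" and w: "w \<noteq> []"
    and c: "\<And>a. a \<in> A n \<Longrightarrow> \<bar>real (card (occurrences w (\<sigma> n [a]))) / real (height 0 n) - c\<bar> \<le> \<delta>"
  shows "\<bar>measure \<mu> {x \<in> X 0. map x [0..int (length w) - 1] = w} - c\<bar>
    \<le> \<delta> + real (length w) / real (height 0 n)"
proof -
  interpret prob_space \<mu> using invariant_probability_facts[OF \<mu>] by blast
  let ?h = "height 0 n" and ?m = "length w"
  let ?C = "{x \<in> X 0. map x [0..int ?m - 1] = w}"
  define t where "t a = measure \<mu> (tower_base n a)" for a
  define q where "q a = real (card (occurrences w (\<sigma> n [a])))" for a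
  have h: "?h > 0" by (rule height_pos)
  have tsum: "(\<Sum>a\<in>A n. real ?h * t a) = 1" using sum_tower_base[OF \<mu>] by (simp add: t_def)
  have C: "?C \<in> sets \<mu>"
    using invariant_probability_word_cylinder(1)[OF \<mu>[unfolded level_subshift_eq]] by (simp add: level_subshift_eq)
  have level: "q a * t a \<le> (\<Sum>k<?h. measure \<mu> (?C \<inter> (bi_shift ^^ k) ` tower_base n a)) \<and>
      (\<Sum>k<?h. measure \<mu> (?C \<inter> (bi_shift ^^ k) ` tower_base n a)) \<le> (q a + real ?m) * t a"
    if a: "a \<in> A n" for a
  proof -
    let ?O = "occurrences w (\<sigma> n [a])" and ?M = "{?h - ?m..<?h}"
    let ?f = "\<lambda>k. measure \<mu> (?C \<inter> (bi_shift ^^ k) ` tower_base n a)"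
    have len: "length (\<sigma> n [a]) = ?h" by (rule compose_length[OF le0 a])
    have O: "?O \<subseteq> {..<?h}" using occurrences_subset[OF w, of "\<sigma> n [a]"] by (simp only: len)
    have sub: "(bi_shift ^^ k) ` tower_base n a \<subseteq> X 0" for k
      using tower_base_subset[OF a] bi_shift_X by blast
    have le: "?f k \<le> t a" for k
      using finite_measure_mono[of "?C \<inter> (bi_shift ^^ k) ` tower_base n a" "(bi_shift ^^ k) ` tower_base n a"]
        tower_level_measurable[OF \<mu>] measure_tower_level[OF \<mu> a] by (simp add: t_def)
    have occ: "?f k = t a" if k: "k \<in> ?O" for k
    proof -
      have "?C \<inter> (bi_shift ^^ k) ` tower_base n a = (bi_shift ^^ k) ` tower_base n a"
        using k sub tower_level_letter[of _ k n a ?m] by (fastforce simp: occurrences_def len)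
      then show ?thesis using measure_tower_level[OF \<mu> a] by (simp add: t_def)
    qed
    have not_occ: "?f k = 0" if k: "k < ?h" "k \<notin> ?O" "k \<notin> ?M" for k
    proof -
      have "?C \<inter> (bi_shift ^^ k) ` tower_base n a = {}"
        using k tower_level_letter[of _ k n a ?m] by (fastforce simp: occurrences_def len)
      then show ?thesis by (simp only: measure_empty)
    qed
    have "q a * t a = (\<Sum>k\<in>?O. ?f k)" using occ by (simp add: q_def)
    also have "\<dots> \<le> (\<Sum>k<?h. ?f k)" using O by (intro sum_mono2) auto
    finally have 1: "q a * t a \<le> (\<Sum>k<?h. ?f k)" .
    have "(\<Sum>k<?h. ?f k) = (\<Sum>k\<in>?O \<union> ?M. ?f k)"
    proof (rule sum.mono_neutral_right)
      show "\<forall>k\<in>{..<?h} - (?O \<union> ?M). ?f k = 0"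
      proof
        fix k assume "k \<in> {..<?h} - (?O \<union> ?M)"
        then show "?f k = 0" by (intro not_occ) (simp_all only: Diff_iff Un_iff lessThan_iff de_Morgan_disj not_False_eq_True)
      qed
    qed (use O in auto)
    also have "\<dots> \<le> (\<Sum>k\<in>?O \<union> ?M. t a)" using le by (intro sum_mono) auto
    also have "\<dots> = real (card (?O \<union> ?M)) * t a" by simp
    also have "card (?O \<union> ?M) \<le> card ?O + ?m" by (rule order_trans[OF card_Un_le]) simp
    then have "real (card (?O \<union> ?M)) * t a \<le> (q a + real ?m) * t a"
      by (intro mult_right_mono) (auto simp: q_def t_def)
    finally show ?thesis using 1 by simp
  qed
  have \<mu>C: "measure \<mu> ?C = (\<Sum>a\<in>A n. \<Sum>k<?h. measure \<mu> (?C \<inter> (bi_shift ^^ k) ` tower_base n a))"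
    by (rule measure_partition[OF \<mu> C])
  have oc: "(c - \<delta>) * real ?h \<le> q a" "q a \<le> (c + \<delta>) * real ?h" if "a \<in> A n" for a
  proof -
    have "c - \<delta> \<le> q a / real ?h" "q a / real ?h \<le> c + \<delta>" using c[OF that] unfolding q_def by linarith+
    then show "(c - \<delta>) * real ?h \<le> q a" "q a \<le> (c + \<delta>) * real ?h" using h by (auto simp: field_simps)
  qed
  \<comment> \<open>The tower masses \<open>?h * t a\<close> sum to \<open>1\<close>, so bounds on
    \<open>q a / ?h\<close> that are uniform in \<open>a\<close> pass to the weighted
    average.\<close>
  have "c - \<delta> = (\<Sum>a\<in>A n. (c - \<delta>) * real ?h * t a)"
    using tsum by (simp add: mult.assoc flip: sum_distrib_left)
  also have "\<dots> \<le> (\<Sum>a\<in>A n. q a * t a)" using oc by (intro sum_mono mult_right_mono) (auto simp: t_def)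
  also have "\<dots> \<le> measure \<mu> ?C" unfolding \<mu>C using level by (intro sum_mono) auto
  finally have lower: "c - \<delta> \<le> measure \<mu> ?C" .
  have "measure \<mu> ?C \<le> (\<Sum>a\<in>A n. (q a + real ?m) * t a)" unfolding \<mu>C using level by (intro sum_mono) auto
  also have "\<dots> \<le> (\<Sum>a\<in>A n. ((c + \<delta>) * real ?h + real ?m) * t a)"
    using oc by (intro sum_mono mult_right_mono add_right_mono) (auto simp: t_def)
  also have "\<dots> = (\<Sum>a\<in>A n. (c + \<delta> + real ?m / real ?h) * (real ?h * t a))"
    using h by (intro sum.cong) (auto simp: field_simps)
  also have "\<dots> = c + \<delta> + real ?m / real ?h" using tsum by (simp flip: sum_distrib_left)
  finally show ?thesis using lower h by (simp add: abs_le_iff) (smt (verit) divide_nonneg_nonneg of_nat_0_le_iff)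
qed

text \<open>The lift is the average of the images of \<open>\<nu>\<close> under the maps
  \<open>f k\<close>. One shift turns \<open>f k\<close> into \<open>f (Suc k)\<close>, so
  invariance reduces to comparing the two ends of the sum.\<close>

lemma lift_level_measure:
  assumes \<nu>: "invariant_probability (T n) bi_shift \<nu>"
  shows "\<exists>\<mu>. invariant_probability (T 0) bi_shift \<mu> \<and>
    (\<forall>a\<in>A n. real (height 0 n) * measure \<mu> (tower_base n a) = measure \<nu> (letter_cylinder A \<tau> n a))"
proof -
  interpret \<nu>: prob_space \<nu> using invariant_probability_facts[OF \<nu>] by blast
  note space_\<nu> = invariant_probability_facts(3)[OF \<nu>]
  let ?h = "height 0 n"
  let ?M = "borel_sigma (T 0)"
  define f where "f k y = (bi_shift ^^ k) (bi_image (\<sigma> n) y)" for k y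
  have f: "f k \<in> measurable \<nu> ?M" for k
    using measurable_continuous_map[OF continuous_level_image[of n k]]
      measurable_cong_sets[OF invariant_probability_facts(2)[OF \<nu>] refl] unfolding f_def by blast
  have fX: "f k y \<in> X 0" if "y \<in> X n" for k y
    unfolding f_def using that by (intro bi_shift_X bi_image_X)
  define m where "m B = ennreal (1 / real ?h) * (\<Sum>k<?h. emeasure \<nu> (f k -` B \<inter> X n))" for B
  define \<mu> where "\<mu> = measure_of (X 0) (sets ?M) m"
  have sp: "space ?M = X 0" by (simp add: topspace_subshift_topology[OF X_subset])
  have sub: "sets ?M \<subseteq> Pow (X 0)" using sets.space_closed[of ?M] unfolding sp .
  have sets_\<mu>: "sets \<mu> = sets ?M"
    using sets.sigma_sets_eq[of ?M] unfolding \<mu>_def sets_measure_of[OF sub] sp .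
  have space_\<mu>: "space \<mu> = X 0" using sets_eq_imp_space_eq[OF sets_\<mu>] sp by simp
  have fB: "f k -` B \<inter> X n \<in> sets \<nu>" if "B \<in> sets ?M" for B k
    using measurable_sets[OF f that] by (simp add: space_\<nu>)
  have em: "emeasure \<mu> B = m B" if B: "B \<in> sets ?M" for B
  proof (rule emeasure_measure_of[OF \<mu>_def])
    show "sets ?M \<subseteq> Pow (X 0)" by (rule sub)
    show "B \<in> sets \<mu>" using B sets_\<mu> by simp
    show "positive (sets \<mu>) m" by (simp add: positive_def m_def)
    show "countably_additive (sets \<mu>) m"
    proof (rule countably_additiveI)
      fix B :: "nat \<Rightarrow> _" assume B: "range B \<subseteq> sets \<mu>" "disjoint_family B"
      have "(\<Sum>i. emeasure \<nu> (f k -` B i \<inter> X n)) = emeasure \<nu> (f k -` (\<Union>i. B i) \<inter> X n)" for k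
      proof -
        have "(\<Sum>i. emeasure \<nu> (f k -` B i \<inter> X n)) = emeasure \<nu> (\<Union>i. f k -` B i \<inter> X n)"
          using B fB sets_\<mu> by (intro suminf_emeasure) (auto simp: disjoint_family_on_def)
        also have "(\<Union>i. f k -` B i \<inter> X n) = f k -` (\<Union>i. B i) \<inter> X n" by blast
        finally show ?thesis .
      qed
      then show "(\<Sum>i. m (B i)) = m (\<Union>i. B i)"
        unfolding m_def ennreal_suminf_cmult by (simp add: suminf_sum[OF summableI])
    qed
  qed
  have m1: "m (X 0) = 1"
  proof -
    have "f k -` X 0 \<inter> X n = space \<nu>" for k using fX space_\<nu> by auto
    then show ?thesis using height_pos[of 0 n] unfolding m_def
      by (simp add: \<nu>.emeasure_space_1 ennreal_of_nat_eq_real_of_nat flip: ennreal_mult)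
  qed
  have inv: "m (bi_shift -` B \<inter> X 0) = m B" if B: "B \<in> sets ?M" for B
  proof -
    let ?g = "\<lambda>k. emeasure \<nu> (f k -` B \<inter> X n)"
    have "f k -` (bi_shift -` B \<inter> X 0) \<inter> X n = f (Suc k) -` B \<inter> X n" for k
      using fX by (auto simp: f_def)
    then have "m (bi_shift -` B \<inter> X 0) = ennreal (1 / real ?h) * (\<Sum>k<?h. ?g (Suc k))" by (simp add: m_def)
    \<comment> \<open>By constant length \<open>?h\<close> shifts at level \<open>0\<close> are one
      shift at level \<open>n\<close>, under which \<open>\<nu>\<close> is invariant.\<close>
    moreover have "?g ?h = ?g 0"
    proof -
      have "f ?h -` B \<inter> X n = bi_shift -` (f 0 -` B \<inter> X n) \<inter> space \<nu>"
      proof -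
        have "f ?h y = f 0 (bi_shift y)" if "y \<in> X n" for y
          unfolding f_def by (simp add: bi_shift_bi_image[OF level_morphism] X_letter[OF that])
        moreover have "bi_shift y \<in> X n" if "y \<in> X n" for y using bi_shift_X[OF that, of 1] by simp
        ultimately show ?thesis using space_\<nu> by auto
      qed
      moreover have "emeasure \<nu> (bi_shift -` (f 0 -` B \<inter> X n) \<inter> space \<nu>) = ?g 0"
        using \<nu> fB[OF B] unfolding invariant_probability_def by blast
      ultimately show ?thesis by (simp only:)
    qed
    moreover have "(\<Sum>k<?h. ?g (Suc k)) = (\<Sum>k<?h. ?g k)" if "?g ?h = ?g 0"
    proof -
      obtain p where p: "?h = Suc p" using height_pos[of 0 n] gr0_implies_Suc by blast
      have "(\<Sum>k<Suc p. ?g k) = ?g 0 + (\<Sum>k<p. ?g (Suc k))" by (rule sum.lessThan_Suc_shift)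
      moreover have "(\<Sum>k<Suc p. ?g (Suc k)) = (\<Sum>k<p. ?g (Suc k)) + ?g (Suc p)" by simp
      ultimately show ?thesis using that unfolding p by (simp add: add.commute)
    qed
    ultimately show ?thesis by (simp add: m_def)
  qed
  have \<mu>: "invariant_probability (T 0) bi_shift \<mu>"
    unfolding invariant_probability_def
  proof (intro conjI ballI sets_\<mu>)
    show "prob_space \<mu>"
      by (rule prob_spaceI) (use em[OF sets.top] m1 space_\<mu> sp in simp)
    have S: "bi_shift \<in> measurable ?M ?M"
      using measurable_continuous_map[OF continuous_bi_shift[of "A 0" "level_language A \<tau> 0" 1]]
      by (simp add: level_subshift_eq)
    fix B assume "B \<in> sets \<mu>"
    then have B: "B \<in> sets ?M" by (simp add: sets_\<mu>)
    have "bi_shift -` B \<inter> X 0 \<in> sets ?M" using measurable_sets[OF S B] unfolding sp .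
    then show "emeasure \<mu> (bi_shift -` B \<inter> space \<mu>) = emeasure \<mu> B"
      using em[OF B] em inv[OF B] unfolding space_\<mu> by simp
  qed
  moreover have "real ?h * measure \<mu> (tower_base n a) = measure \<nu> (letter_cylinder A \<tau> n a)" if a: "a \<in> A n" for a
  proof -
    have in_tower: "f k y \<in> (bi_shift ^^ k) ` tower_base n (y 0)" if "y \<in> X n" for k y
      using that by (auto simp: f_def tower_base_def letter_cylinder_def)
    \<comment> \<open>The point \<open>f k y\<close> lies on level \<open>k\<close> of the tower
      over \<open>y 0\<close>; by disjointness of the levels only \<open>f 0\<close>, applied to the
      cylinder of \<open>a\<close>, reaches the base over \<open>a\<close>.\<close>
    have key: "y 0 = a \<and> k = 0" if y: "y \<in> X n" "k < ?h" "f k y \<in> tower_base n a" for k y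
    proof -
      have "f k y \<in> (bi_shift ^^ 0) ` tower_base n a" using y(3) by simp
      then show ?thesis
        using level_partition_unique[OF X_letter[OF y(1), of 0] a y(2) height_pos in_tower[OF y(1), of k]] by blast
    qed
    have "emeasure \<nu> (f k -` tower_base n a \<inter> X n) = (if k = 0 then emeasure \<nu> (letter_cylinder A \<tau> n a) else 0)"
      if "k < ?h" for k
    proof (cases "k = 0")
      case True
      have "f 0 -` tower_base n a \<inter> X n = letter_cylinder A \<tau> n a"
        using key[of _ 0] height_pos[of 0 n] by (auto simp: f_def tower_base_def letter_cylinder_def)
      then show ?thesis using True by simp
    next
      case False
      then have "f k -` tower_base n a \<inter> X n = {}" using key[OF _ that] by blast
      then show ?thesis using False by simp
    qed
    then have "(\<Sum>k<?h. emeasure \<nu> (f k -` tower_base n a \<inter> X n)) = (\<Sum>k<?h. if k = 0 then emeasure \<nu> (letter_cylinder A \<tau> n a) else 0)"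
      by (intro sum.cong) auto
    also have "\<dots> = emeasure \<nu> (letter_cylinder A \<tau> n a)" using height_pos[of 0 n] by (simp add: sum.delta)
    finally have "m (tower_base n a) = ennreal (1 / real ?h) * emeasure \<nu> (letter_cylinder A \<tau> n a)" by (simp add: m_def)
    moreover have "tower_base n a \<in> sets ?M" using tower_level_measurable[OF \<mu>, of 0] by (simp add: sets_\<mu>)
    ultimately have "emeasure \<mu> (tower_base n a) = ennreal (1 / real ?h * measure \<nu> (letter_cylinder A \<tau> n a))"
      using em by (subst ennreal_mult) (simp_all add: \<nu>.emeasure_eq_measure)
    then have "measure \<mu> (tower_base n a) = 1 / real ?h * measure \<nu> (letter_cylinder A \<tau> n a)"
      by (simp add: measure_def)
    then show ?thesis using height_pos[of 0 n] by simp
  qed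
  ultimately show ?thesis by blast
qed

text \<open>Bad pairs \<open>N\<close>, \<open>b\<close> at arbitrarily high levels would accumulate
  at an invariant probability of level \<open>n\<close>. Its lift is \<open>\<mu>\<close> by
  uniqueness, which fixes its letter frequencies, a contradiction. Choosing \<open>b\<close> anew at
  each level gives uniformity in \<open>b\<close>.\<close>

lemma eventually_frequencies_close:
  assumes \<mu>: "invariant_probability (T 0) bi_shift \<mu>"
    and unique: "\<And>\<mu>'. invariant_probability (T 0) bi_shift \<mu>' \<Longrightarrow> \<mu>' = \<mu>"
    and a: "a \<in> A n" and e: "e > 0"
  shows "\<forall>\<^sub>F N in sequentially. \<forall>b\<in>A N. \<bar>real (count_list (compose_range \<tau> n N [b]) a) / real (height n N)
    - real (height 0 n) * measure \<mu> (tower_base n a)\<bar> < e"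
proof (rule ccontr)
  let ?q = "\<lambda>N b. real (count_list (compose_range \<tau> n N [b]) a) / real (height n N)"
  let ?c = "real (height 0 n) * measure \<mu> (tower_base n a)"
  assume "\<not> ?thesis"
  then have "\<forall>M. \<exists>N\<ge>M. \<exists>b\<in>A N. \<not> \<bar>?q N b - ?c\<bar> < e"
    unfolding eventually_sequentially by blast
  \<comment> \<open>Starting at \<open>Suc (n + j)\<close> provides both inequalities needed for the
    empirical limit, \<open>n < Ns j\<close> and \<open>j \<le> Ns j\<close>.\<close>
  then have "\<forall>j. \<exists>N b. Suc (n + j) \<le> N \<and> b \<in> A N \<and> \<not> \<bar>?q N b - ?c\<bar> < e" by blast
  then obtain Ns b where Ns: "\<And>j. Suc (n + j) \<le> Ns j" and b: "\<And>j. b j \<in> A (Ns j)"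
    and far: "\<And>j. \<not> \<bar>?q (Ns j) (b j) - ?c\<bar> < e" by metis
  have Ns': "n < Ns j" "j \<le> Ns j" for j using Ns[of j] by auto
  obtain G \<nu> where G: "G \<noteq> bot" and \<nu>: "invariant_probability (T n) bi_shift \<nu>"
    and lim: "\<forall>a. ((\<lambda>j. real (count_list (compose_range \<tau> n (Ns j) [b j]) a) / real (height n (Ns j))) \<longlongrightarrow>
          measure \<nu> (letter_cylinder A \<tau> n a)) G"
    using level_measure[of n Ns b, OF Ns' b] by blast
  obtain \<mu>' where "invariant_probability (T 0) bi_shift \<mu>'"
    "\<forall>a\<in>A n. real (height 0 n) * measure \<mu>' (tower_base n a) = measure \<nu> (letter_cylinder A \<tau> n a)"
    using lift_level_measure[OF \<nu>] by blast
  then have c: "?c = measure \<nu> (letter_cylinder A \<tau> n a)" using unique a by blast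
  have "\<forall>\<^sub>F j in G. dist (?q (Ns j) (b j)) ?c < e" using lim[rule_format] e unfolding c by (rule tendstoD)
  then obtain j where "dist (?q (Ns j) (b j)) ?c < e" using G eventually_happens' by blast
  then show False using far[of j] by (simp add: dist_real_def)
qed

text \<open>The limit frequencies of the letters are the tower masses, with sum \<open>1\<close>.
  Convergence is uniform in \<open>b\<close>, so the minima over \<open>b\<close> lose only a small
  amount per letter.\<close>

lemma contraction_step:
  assumes "uniquely_ergodic (T 0) bi_shift"
  shows "\<exists>N>n. real (height n N) / 2 \<le> real (\<Sum>a\<in>A n. Min ((\<lambda>b. count_list (compose_range \<tau> n N [b]) a) ` A N))"
proof -
  obtain \<mu> where \<mu>: "invariant_probability (T 0) bi_shift \<mu>"
    and unique: "\<And>\<mu>'. invariant_probability (T 0) bi_shift \<mu>' \<Longrightarrow> \<mu>' = \<mu>"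
    using assms unfolding uniquely_ergodic_def by blast
  \<comment> \<open>An error of \<open>e\<close> for each of the \<open>card (A n)\<close> letters
    costs \<open>1 / 2\<close> in total.\<close>
  define e where "e = 1 / (2 * real (card (A n)))"
  define c where "c a = real (height 0 n) * measure \<mu> (tower_base n a)" for a
  have card: "card (A n) > 0" using fin nonempty by (simp add: card_gt_0_iff)
  then have e: "e > 0" by (simp add: e_def)
  have "\<forall>\<^sub>F N in sequentially. \<forall>a\<in>A n. \<forall>b\<in>A N.
      \<bar>real (count_list (compose_range \<tau> n N [b]) a) / real (height n N) - c a\<bar> < e"
    unfolding c_def using eventually_frequencies_close[OF \<mu> unique _ e]
    by (intro eventually_ball_finite[OF fin]) blast
  then have "\<forall>\<^sub>F N in sequentially. n < N \<and> (\<forall>a\<in>A n. \<forall>b\<in>A N.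
      \<bar>real (count_list (compose_range \<tau> n N [b]) a) / real (height n N) - c a\<bar> < e)"
    using eventually_gt_at_top[of n] by (rule eventually_elim2) blast
  then obtain N where N: "n < N" and close: "\<And>a b. a \<in> A n \<Longrightarrow> b \<in> A N \<Longrightarrow>
      \<bar>real (count_list (compose_range \<tau> n N [b]) a) / real (height n N) - c a\<bar> < e"
    unfolding eventually_sequentially by blast
  let ?v = "\<lambda>a. Min ((\<lambda>b. count_list (compose_range \<tau> n N [b]) a) ` A N)"
  have h: "real (height n N) > 0" using height_pos by simp
  have "(c a - e) * real (height n N) \<le> real (?v a)" if a: "a \<in> A n" for a
  proof -
    have "?v a \<in> (\<lambda>b. count_list (compose_range \<tau> n N [b]) a) ` A N"
      using fin nonempty by (intro Min_in) auto
    then obtain b where b: "b \<in> A N" "?v a = count_list (compose_range \<tau> n N [b]) a" by blast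
    have "c a - e \<le> real (?v a) / real (height n N)" using close[OF a b(1)] unfolding b(2) by linarith
    then show ?thesis using h by (simp add: pos_le_divide_eq)
  qed
  then have "(\<Sum>a\<in>A n. (c a - e) * real (height n N)) \<le> (\<Sum>a\<in>A n. real (?v a))" by (rule sum_mono)
  moreover have "(\<Sum>a\<in>A n. (c a - e) * real (height n N)) = real (height n N) / 2"
    using sum_tower_base[OF \<mu>, of n] card
    by (simp add: c_def e_def sum_subtractf flip: sum_distrib_right)
  ultimately show ?thesis using N by auto
qed

text \<open>At a high level all blocks contain a given word with almost the same frequency, and
  every invariant probability must give the word nearly this mass.\<close>

lemma uniquely_ergodic_if_contraction:
  assumes ns: "strict_mono ns"
    and v: "\<And>k b a. b \<in> A (ns (Suc k)) \<Longrightarrow> a \<in> A (ns k) \<Longrightarrow>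
      v k a \<le> count_list (compose_range \<tau> (ns k) (ns (Suc k)) [b]) a"
    and div: "\<not> summable (\<lambda>k. real (\<Sum>a\<in>A (ns k). v k a) / real (height (ns k) (ns (Suc k))))"
  shows "uniquely_ergodic (T 0) bi_shift"
proof -
  \<comment> \<open>Existence: the empirical limit along an arbitrary choice of letters.\<close>
  have "\<forall>j. \<exists>b. b \<in> A (Suc j)" using nonempty by blast
  then obtain b where b: "\<And>j. b j \<in> A (Suc j)" by metis
  obtain \<mu> where \<mu>: "invariant_probability (T 0) bi_shift \<mu>"
    using level_measure[of 0 Suc b, OF _ _ b] by auto
  have "\<mu>' = \<mu>" if \<mu>': "invariant_probability (T 0) bi_shift \<mu>'" for \<mu>'
  proof (rule invariant_probability_eqI[OF fin[of 0] \<mu>'[unfolded level_subshift_eq] \<mu>[unfolded level_subshift_eq]])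
    fix w :: "'a list" assume w: "w \<noteq> []"
    let ?C = "{x \<in> X 0. map x [0..int (length w) - 1] = w}"
    \<comment> \<open>Each measure is within \<open>e / 4 + e / 4\<close> of a common constant: one
      quarter for the oscillation, one for the windows leaving a block. The form
      \<open>0 + e\<close> fits \<open>field_le_epsilon\<close>.\<close>
    have "\<bar>measure \<mu>' ?C - measure \<mu> ?C\<bar> \<le> 0 + e" if e: "e > 0" for e
    proof -
      obtain M where M: "nat \<lceil>4 * real (length w) / e\<rceil> \<le> height 0 M" using unbounded by blast
      obtain N c where N: "N \<ge> M" and c: "\<And>a. a \<in> A N \<Longrightarrow>
          \<bar>real (card (occurrences w (\<sigma> N [a]))) / real (height 0 N) - c\<bar> \<le> e / 4"
        using frequency_oscillation[OF ns v div w, of "e / 4" M] e by auto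
      have "nat \<lceil>4 * real (length w) / e\<rceil> \<le> height 0 N" using M height_mono[OF N, of 0] by simp
      then have "4 * real (length w) / e \<le> real (height 0 N)" by linarith
      then have "real (length w) / real (height 0 N) \<le> e / 4"
        using e height_pos[of 0 N] by (simp add: field_simps)
      then show ?thesis
        using measure_word_estimate[OF \<mu> w c] measure_word_estimate[OF \<mu>' w c] by linarith
    qed
    then have "\<bar>measure \<mu>' ?C - measure \<mu> ?C\<bar> \<le> 0" by (rule field_le_epsilon)
    then show "measure \<mu>' {x \<in> word_subshift (A 0) (level_language A \<tau> 0). map x [0..int (length w) - 1] = w} =
        measure \<mu> {x \<in> word_subshift (A 0) (level_language A \<tau> 0). map x [0..int (length w) - 1] = w}"
      by (simp add: level_subshift_eq)
  qed
  then show ?thesis unfolding uniquely_ergodic_def using \<mu> by blast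
qed

section \<open>The equivalence\<close>

lemma morphism_length_compose:
  assumes "n \<le> N" shows "morphism_length (A N) (compose_range \<tau> n N) = height n N"
  unfolding morphism_length_def
proof (rule the_equality)
  fix m assume "\<forall>a\<in>A N. length (compose_range \<tau> n N [a]) = m"
  then show "m = height n N" using nonempty[of N] compose_length[OF assms] by auto
qed (use compose_length[OF assms] in blast)

theorem contraction_iff_uniquely_ergodic:
  "(\<exists>A' \<tau>'. is_contraction A \<tau> A' \<tau>' \<and>
      (\<Sum>k. ennreal (real (\<Sum>a \<in> A' k. min_vector A' \<tau>' k a) /
                    real (morphism_length (A' (Suc k)) (\<tau>' k)))) = \<infinity>)
    \<longleftrightarrow> uniquely_ergodic (T 0) bi_shift"
proof
  assume "\<exists>A' \<tau>'. is_contraction A \<tau> A' \<tau>' \<and>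
      (\<Sum>k. ennreal (real (\<Sum>a \<in> A' k. min_vector A' \<tau>' k a) /
                    real (morphism_length (A' (Suc k)) (\<tau>' k)))) = \<infinity>"
  then obtain A' \<tau>' ns where ns: "strict_mono ns"
    and A': "\<And>k. A' k = A (ns k)" and \<tau>': "\<And>k. \<tau>' k = compose_range \<tau> (ns k) (ns (Suc k))"
    and inf: "(\<Sum>k. ennreal (real (\<Sum>a \<in> A' k. min_vector A' \<tau>' k a) /
                    real (morphism_length (A' (Suc k)) (\<tau>' k)))) = \<infinity>"
    unfolding is_contraction_def by blast
  have nsS: "ns k \<le> ns (Suc k)" for k using strict_monoD[OF ns, of k "Suc k"] by simp
  show "uniquely_ergodic (T 0) bi_shift"
  proof (rule uniquely_ergodic_if_contraction[OF ns])
    fix k b a assume "b \<in> A (ns (Suc k))"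
    then show "min_vector A' \<tau>' k a \<le> count_list (compose_range \<tau> (ns k) (ns (Suc k)) [b]) a"
      unfolding min_vector_def A' \<tau>' using fin by (intro Min_le) auto
  next
    show "\<not> summable (\<lambda>k. real (\<Sum>a\<in>A (ns k). min_vector A' \<tau>' k a) / real (height (ns k) (ns (Suc k))))"
    proof
      let ?\<alpha> = "\<lambda>k. real (\<Sum>a\<in>A (ns k). min_vector A' \<tau>' k a) / real (height (ns k) (ns (Suc k)))"
      assume "summable ?\<alpha>"
      then have "(\<Sum>k. ennreal (?\<alpha> k)) = ennreal (\<Sum>k. ?\<alpha> k)"
        by (intro suminf_ennreal2) (simp_all only: divide_nonneg_nonneg of_nat_0_le_iff)
      then show False using inf unfolding A' \<tau>' morphism_length_compose[OF nsS] by simp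
    qed
  qed
next
  assume "uniquely_ergodic (T 0) bi_shift"
  then have "\<forall>n. \<exists>N>n. real (height n N) / 2 \<le>
      real (\<Sum>a\<in>A n. Min ((\<lambda>b. count_list (compose_range \<tau> n N [b]) a) ` A N))"
    using contraction_step by blast
  then obtain next_level where gt: "\<And>n. n < next_level n"
    and half: "\<And>n. real (height n (next_level n)) / 2 \<le>
      real (\<Sum>a\<in>A n. Min ((\<lambda>b. count_list (compose_range \<tau> n (next_level n) [b]) a) ` A (next_level n)))"
    by metis
  \<comment> \<open>Each step starts at the level where the previous one ended, so every quotient of
    the resulting contraction is at least \<open>1 / 2\<close>.\<close>
  define ns where "ns k = (next_level ^^ k) 0" for k
  have nsS: "ns (Suc k) = next_level (ns k)" for k by (simp add: ns_def)
  have mono: "strict_mono ns" by (rule strict_monoI_Suc) (simp add: nsS gt)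
  define A' where "A' k = A (ns k)" for k
  define \<tau>' where "\<tau>' k = compose_range \<tau> (ns k) (ns (Suc k))" for k
  have "is_contraction A \<tau> A' \<tau>'"
    unfolding is_contraction_def using mono by (intro exI[of _ ns]) (simp add: A'_def \<tau>'_def ns_def)
  moreover have "(\<Sum>k. ennreal (real (\<Sum>a \<in> A' k. min_vector A' \<tau>' k a) /
                    real (morphism_length (A' (Suc k)) (\<tau>' k)))) = \<infinity>"
  proof -
    define \<alpha> where "\<alpha> k = real (\<Sum>a \<in> A' k. min_vector A' \<tau>' k a) / real (morphism_length (A' (Suc k)) (\<tau>' k))" for k
    have ge: "1 / 2 \<le> \<alpha> k" for k
    proof -
      have len: "morphism_length (A' (Suc k)) (\<tau>' k) = height (ns k) (next_level (ns k))"
        unfolding A'_def \<tau>'_def nsS by (rule morphism_length_compose) (simp add: gt less_imp_le)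
      show ?thesis using half[of "ns k"] height_pos[of "ns k" "next_level (ns k)"]
        unfolding \<alpha>_def len by (simp add: min_vector_def A'_def \<tau>'_def nsS pos_le_divide_eq del: of_nat_sum)
    qed
    have "\<not> summable \<alpha>"
    proof
      assume "summable \<alpha>"
      then have "\<alpha> \<longlonglongrightarrow> 0" by (rule summable_LIMSEQ_zero)
      then have "1 / 2 \<le> (0::real)" by (rule LIMSEQ_le_const) (use ge in blast)
      then show False by simp
    qed
    moreover have "0 \<le> \<alpha> k" for k using ge[of k] by linarith
    ultimately have "(\<Sum>k. ennreal (\<alpha> k)) = top" using summable_suminf_not_top by blast
    then show ?thesis unfolding \<alpha>_def by (simp add: infinity_ennreal_def)
  qed
  ultimately show "\<exists>A' \<tau>'. is_contraction A \<tau> A' \<tau>' \<and>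
      (\<Sum>k. ennreal (real (\<Sum>a \<in> A' k. min_vector A' \<tau>' k a) /
                    real (morphism_length (A' (Suc k)) (\<tau>' k)))) = \<infinity>" by blast
qed

end

theorem theorem11:
  fixes A :: "nat \<Rightarrow> 'a set" and \<tau> :: "nat \<Rightarrow> 'a list \<Rightarrow> 'a list"
  assumes "directive_sequence A \<tau>"
    and "constant_length_sequence A \<tau>"
    and "level_subshift A \<tau> 0 \<noteq> {}"
    and "recognizable A \<tau>"
  shows "(\<exists>A' \<tau>'. is_contraction A \<tau> A' \<tau>' \<and>
            (\<Sum>k. ennreal (real (\<Sum>a \<in> A' k. min_vector A' \<tau>' k a) /
                          real (morphism_length (A' (Suc k)) (\<tau>' k)))) = \<infinity>)
     \<longleftrightarrow> uniquely_ergodic (subshift_topology (A 0) (level_subshift A \<tau> 0)) bi_shift"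
proof -
  have "\<forall>n. \<exists>l. \<forall>b\<in>A (Suc n). length (\<tau> n [b]) = l"
    using assms(2) by (simp add: constant_length_sequence_def constant_length_def)
  then obtain l where l: "\<And>n b. b \<in> A (Suc n) \<Longrightarrow> length (\<tau> n [b]) = l n" by metis
  interpret uniform_directive A \<tau> l
  proof
    fix n
    obtain b where b: "b \<in> A (Suc n)" using assms(1) by (force simp: directive_sequence_def)
    then have "\<tau> n [b] \<noteq> []" using assms(1) by (auto simp: directive_sequence_def nonerasing_def)
    then show "l n > 0" using l[OF b] by (metis length_greater_0_conv)
  qed (use assms(1) l in \<open>auto simp: directive_sequence_def\<close>)
  interpret growing_directive A \<tau> l
  proof
    fix M
    \<comment> \<open>A point of the subshift contains a word of length \<open>M\<close>, which is a
      factor of some \<open>\<tau>\<close>-image of a single letter; the length of that image is a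
      height.\<close>
    obtain x where "x \<in> level_subshift A \<tau> 0" using assms(3) by blast
    then have "map x [1..int M] \<in> level_language A \<tau> 0" by (simp add: level_subshift_def)
    then obtain N a where "a \<in> A N" "sublist (map x [1..int M]) (compose_range \<tau> 0 N [a])"
      by (auto simp: level_language_def)
    then have "length (map x [1..int M]) \<le> height 0 N"
      using sublist_length_le compose_length[OF le0] by metis
    then show "\<exists>N. M \<le> height 0 N" by auto
  qed
  interpret recognizable_directive A \<tau> l by unfold_locales (rule assms(4))
  show ?thesis by (rule contraction_iff_uniquely_ergodic)
qed

end
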